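(* Let $m,n$ be positive integers with $m+n$ odd, let $G=G^{(m,n)}$ and $k=\frac{m+n+1}{2}$. Then there is a bijection between the set $\mathcal{D}(G)$ of dimer coverings of $G$ and the set $\mathcal{F}(G,P)$ of triples $(F_1,F_2,\{e_j\}_{j=1}^k)$ such that: $F_j$ is a spanning forest of $G_j$ with exactly $k$ connected components ($j=1,2$); $\{e_j\}_{j=1}^k\subset E_2$ is a set of $k$ edges (the configuration of impurities); and condition (P) holds: (P)(1) $F_1$ and $F_2$ have no intersections, i.e. no vertex of $V_3$ is the middle vertex of both an edge of $F_1$ and an edge of $F_2$; (P)(2) the trees of $F_1$ are paired with those of $F_2$ by the impurities, i.e. each tree of $F_1$ contains the $V_1$-endpoint of exactly one $e_j$, and each tree of $F_2$ contains the $V_2$-endpoint of exactly one $e_j$.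
   Context: Let $\mathcal{G}$ be the graph with vertex set $\mathcal{V}=\mathbb{Z}^2\cup(\mathbb{Z}^2+(\frac12,\frac12))$ in which two vertices are adjacent iff their Euclidean distance is $1$ or $\frac{\sqrt2}{2}$; edges are unoriented. Put $\mathcal{V}_1=\{(x,y)\in\mathbb{Z}^2: x-y\in 2\mathbb{Z}\}$, $\mathcal{V}_2=\{(x,y)\in\mathbb{Z}^2: x-y\in 2\mathbb{Z}+1\}$, $\mathcal{V}_3=\mathbb{Z}^2+(\frac12,\frac12)$; let $\mathcal{E}_1$ be the edges joining a point of $\mathbb{Z}^2$ to a point of $\mathcal{V}_3$ and $\mathcal{E}_2$ the edges joining two points of $\mathbb{Z}^2$ (so every edge of $\mathcal{E}_2$ joins a point of $\mathcal{V}_1$ to a point of $\mathcal{V}_2$). For a finite subgraph $G$ of $\mathcal{G}$ put $V_i=V(G)\cap\mathcal{V}_i$, $E_i=E(G)\cap\mathcal{E}_i$. A dimer covering of $G$ is a set $M\subset E(G)$ such that every vertex of $G$ lies in exactly one edge of $M$ (a perfect matching); the edges of $M\cap E_2$ are called impurities. $G^{(m,n)}$ is the subgraph of $\mathcal{G}$ induced by $\{(x,y)\in\mathbb{Z}^2:0\le x\le m,\,0\le y\le n\}\cup\{(x+\frac12,y+\frac12):x,y\in\mathbb{Z},\,0\le x\le m-1,\,0\le y\le n-1\}$ (an $m\times n$ rectangle of unit squares together with their centers); every dimer covering of it has exactly $\frac{m+n+1}{2}$ impurities, which forces $m+n$ odd. For $j=1,2$, $G_j$ is the graph with vertex set $V_j$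 in which $x,y\in V_j$ are adjacent iff there is $z\in V_3$ adjacent in $G$ to both $x$ and $y$; $z$ is called the middle vertex of the edge $(x,y)$ (so edges of $G_j$ are diagonals of unit squares of the rectangle, with the square's center as middle vertex).
   Formalization: Edges of the graph are only those in E_1 and E_2: centers of neighboring squares, though at distance 1, are not adjacent. With such edges the claim fails (for m=1, n=2 there are 11 dimer coverings but 8 triples). *)

theory Defs
  imports "HOL-Analysis.Analysis"
begin

section \<open>Simple graphs\<close>

text \<open>An undirected simple graph is a pair of a vertex set and a set of two-element edges.\<close>

type_synonym 'a ugraph = "'a set \<times> 'a set set"

abbreviation verts :: "'a ugraph \<Rightarrow> 'a set" where "verts G \<equiv> fst G"
abbreviation edges :: "'a ugraph \<Rightarrow> 'a set set" where "edges G \<equiv> snd G"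

definition induced_subgraph :: "'a ugraph \<Rightarrow> 'a set \<Rightarrow> 'a ugraph" where
  "induced_subgraph G W = (verts G \<inter> W, {e \<in> edges G. e \<subseteq> W})"

definition dimer_coverings :: "'a ugraph \<Rightarrow> 'a set set set" where
  "dimer_coverings G = {M. M \<subseteq> edges G \<and> (\<forall>v\<in>verts G. \<exists>!e. e \<in> M \<and> v \<in> e)}"

definition reachable :: "'a ugraph \<Rightarrow> ('a \<times> 'a) set" where
  "reachable G = {(u, v). u \<in> verts G \<and> v \<in> verts G \<and> (u, v) \<in> {(x, y). {x, y} \<in> edges G}\<^sup>*}"

definition conn_components :: "'a ugraph \<Rightarrow> 'a set set" where
  "conn_components G = verts G // reachable G"

definition is_cycle :: "'a ugraph \<Rightarrow> 'a list \<Rightarrow> bool" where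
  "is_cycle G c \<longleftrightarrow> length c \<ge> 3 \<and> distinct c \<and> set c \<subseteq> verts G \<and>
     (\<forall>i<length c. {c ! i, c ! (Suc i mod length c)} \<in> edges G)"

text \<open>A spanning subgraph has all vertices of the host graph; an isolated vertex is a
  component (a one-vertex tree).\<close>

definition spanning_forest :: "'a ugraph \<Rightarrow> 'a ugraph \<Rightarrow> bool" where
  "spanning_forest G F \<longleftrightarrow> verts F = verts G \<and> edges F \<subseteq> edges G \<and> (\<nexists>c. is_cycle F c)"


section \<open>The square lattice with face centers\<close>

text \<open>The distance on pairs of reals is the Euclidean one.\<close>

type_synonym point = "real \<times> real"

definition int_lattice :: "point set" where
  "int_lattice = {(of_int x, of_int y) | x y :: int. True}"

definition V1 :: "point set" where
  "V1 = {(of_int x, of_int y) | x y :: int. even (x - y)}"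

definition V2 :: "point set" where
  "V2 = {(of_int x, of_int y) | x y :: int. odd (x - y)}"

definition V3 :: "point set" where
  "V3 = {(of_int x + 1/2, of_int y + 1/2) | x y :: int. True}"

definition near :: "point \<Rightarrow> point \<Rightarrow> bool" where
  "near u v \<longleftrightarrow> dist u v = 1 \<or> dist u v = sqrt 2 / 2"

definition E1 :: "point set set" where
  "E1 = {{u, v} | u v. u \<in> int_lattice \<and> v \<in> V3 \<and> near u v}"

definition E2 :: "point set set" where
  "E2 = {{u, v} | u v. u \<in> int_lattice \<and> v \<in> int_lattice \<and> near u v}"

text \<open>The edges are of the two kinds \<open>E1\<close> and \<open>E2\<close> only: the centers of two neighboring squares
  are also at distance \<open>1\<close>, but they are not joined by an edge. (Such edges would contradict the
  fixed number of impurities in a dimer covering of a rectangle.)\<close>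

definition full_graph :: "point ugraph" where
  "full_graph = (int_lattice \<union> V3, E1 \<union> E2)"

definition rect_graph :: "nat \<Rightarrow> nat \<Rightarrow> point ugraph" where
  "rect_graph m n = induced_subgraph full_graph
     ({(of_int x, of_int y) | x y :: int. 0 \<le> x \<and> x \<le> int m \<and> 0 \<le> y \<and> y \<le> int n} \<union>
      {(of_int x + 1/2, of_int y + 1/2) | x y :: int.
         0 \<le> x \<and> x \<le> int m - 1 \<and> 0 \<le> y \<and> y \<le> int n - 1})"


section \<open>Forests paired by impurities\<close>

definition middle_vertex :: "point ugraph \<Rightarrow> point \<Rightarrow> point set \<Rightarrow> bool" where
  "middle_vertex G z e \<longleftrightarrow> z \<in> verts G \<inter> V3 \<and> (\<forall>x\<in>e. {x, z} \<in> edges G)"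

text \<open>The graphs \<open>G\<^sub>1\<close> and \<open>G\<^sub>2\<close> are obtained for \<open>U = V1\<close> and \<open>U = V2\<close>.\<close>

definition diagonal_graph :: "point ugraph \<Rightarrow> point set \<Rightarrow> point ugraph" where
  "diagonal_graph G U = (verts G \<inter> U,
     {{x, y} | x y. x \<in> verts G \<inter> U \<and> y \<in> verts G \<inter> U \<and> x \<noteq> y \<and> (\<exists>z. middle_vertex G z {x, y})})"

definition no_intersections :: "point ugraph \<Rightarrow> point ugraph \<Rightarrow> point ugraph \<Rightarrow> bool" where
  "no_intersections G F1 F2 \<longleftrightarrow>
     \<not> (\<exists>z \<in> verts G \<inter> V3. \<exists>a \<in> edges F1. \<exists>b \<in> edges F2. middle_vertex G z a \<and> middle_vertex G z b)"

definition paired_by :: "point ugraph \<Rightarrow> point ugraph \<Rightarrow> point set set \<Rightarrow> bool" where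
  "paired_by F1 F2 I \<longleftrightarrow>
     (\<forall>T \<in> conn_components F1. \<exists>!e. e \<in> I \<and> (\<exists>x \<in> e \<inter> V1. x \<in> T)) \<and>
     (\<forall>T \<in> conn_components F2. \<exists>!e. e \<in> I \<and> (\<exists>x \<in> e \<inter> V2. x \<in> T))"

definition forest_triples ::
    "point ugraph \<Rightarrow> nat \<Rightarrow> (point ugraph \<times> point ugraph \<times> point set set) set" where
  "forest_triples G k = {(F1, F2, I).
     spanning_forest (diagonal_graph G V1) F1 \<and> card (conn_components F1) = k \<and>
     spanning_forest (diagonal_graph G V2) F2 \<and> card (conn_components F2) = k \<and>
     I \<subseteq> edges G \<inter> E2 \<and> finite I \<and> card I = k \<and>
     no_intersections G F1 F2 \<and> paired_by F1 F2 I}"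

end

theory Submission
  imports Defs
begin

text \<open>Send a dimer covering to the diagonals of the unit squares that start at the partner of the
  center, one diagonal per square, together with the impurities. The diagonals form a functional graph:
  every lattice point \<open>x\<close> that is matched to a center has exactly one outgoing edge, to the corner
  \<open>p x\<close> opposite to \<open>x\<close> in that square, and the endpoints of impurities are the roots.

  The heart of the matter is that \<open>p\<close> has no cycle. Call a nonempty set \<open>S\<close> of points of one color
  in the open rectangle enclosed if no diagonal joins \<open>S\<close> to its complement. In the squares where \<open>S\<close>
  meets its complement the diagonal then has the other color; an even number of these diagonals meets
  at each point, so they form cycles of \<open>p\<close>. Conversely, a cycle of \<open>p\<close> gives an enclosed set of
  points of the other color (those with odd crossing parity), strictly below the top of the cycle.
  If an enclosed set \<open>S\<close> contains no root, it contains a cycle; if it contains a root, the other end of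
  that impurity is a root whose tree is enclosed and has all its neighbours in \<open>S\<close>. In both cases
  there is an enclosed set with a lower top, so by descent there is none, and hence no cycle.

  Conversely, orient the trees towards the roots given by the impurities and match every other point
  to the middle of its outgoing edge. As the number of such points is the number \<open>mn\<close> of squares,
  all centers are matched and all edges of the forests are used.\<close>

section \<open>Descent: a matching of squares to corners has no cycles\<close>

definition grid :: "int \<Rightarrow> int \<Rightarrow> (int \<times> int) set" where
  "grid m n = {0..m} \<times> {0..n}"

text \<open>A unit square is indexed by its lower left corner.\<close>

definition cells :: "int \<Rightarrow> int \<Rightarrow> (int \<times> int) set" where
  "cells m n = {0..<m} \<times> {0..<n}"

definition corner :: "int \<times> int \<Rightarrow> int \<times> int \<Rightarrow> bool" where
  "corner x z \<longleftrightarrow> (fst x = fst z \<or> fst x = fst z + 1) \<and> (snd x = snd z \<or> snd x = snd z + 1)"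

definition opp :: "int \<times> int \<Rightarrow> int \<times> int \<Rightarrow> int \<times> int" where
  "opp z x = (2 * fst z + 1 - fst x, 2 * snd z + 1 - snd x)"

definition colour :: "int \<times> int \<Rightarrow> bool" where
  "colour x \<longleftrightarrow> even (fst x - snd x)"

definition adjacent :: "int \<times> int \<Rightarrow> int \<times> int \<Rightarrow> bool" where
  "adjacent x y \<longleftrightarrow> \<bar>fst x - fst y\<bar> + \<bar>snd x - snd y\<bar> = 1"

lemma corner_opp: "corner x z \<Longrightarrow> corner (opp z x) z"
  by (auto simp: corner_def opp_def)

lemma opp_opp [simp]: "opp z (opp z x) = x"
  by (simp add: opp_def)

lemma opp_neq: "opp z x \<noteq> x"
proof
  assume "opp z x = x"
  then have "2 * fst z + 1 = 2 * fst x"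
    by (simp add: opp_def prod_eq_iff)
  then show False
    by presburger
qed

lemma colour_opp [simp]: "colour (opp z x) = colour x"
proof -
  have "2 * fst z + 1 - fst x - (2 * snd z + 1 - snd x) = 2 * (fst z - snd z - fst x + snd x) + (fst x - snd x)"
    by simp
  then show ?thesis
    unfolding colour_def opp_def fst_conv snd_conv by presburger
qed

lemma same_colour_corners:
  assumes "corner x z" "corner y z" "colour x = colour y"
  shows "y = x \<or> y = opp z x"
proof -
  have "fst y = fst x \<longleftrightarrow> snd y = snd x"
    using assms unfolding corner_def colour_def by presburger
  then show ?thesis
    using assms(1,2) unfolding corner_def opp_def prod_eq_iff fst_conv snd_conv by presburger
qed

lemma opp_in_grid: "corner x z \<Longrightarrow> z \<in> cells m n \<Longrightarrow> opp z x \<in> grid m n"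
  by (auto simp: corner_def opp_def cells_def grid_def)

lemma finite_grid [simp]: "finite (grid m n)"
  by (simp add: grid_def)

lemma finite_cells [simp]: "finite (cells m n)"
  by (simp add: cells_def)

text \<open>Replacing the set by its image shrinks it until it is its own image. On the result
  \<open>p\<close> is a permutation, so that the result is a union of cycles.\<close>

lemma invariant_core:
  assumes "finite X" "X \<noteq> {}" "p ` X \<subseteq> X"
  obtains Y where "Y \<subseteq> X" "Y \<noteq> {}" "p ` Y = Y"
  using assms
proof (induction X arbitrary: thesis rule: finite_psubset_induct)
  case (psubset X)
  show ?case
  proof (cases "p ` X = X")
    case True
    then show ?thesis using psubset.prems by blast
  next
    case False
    then have "p ` X \<subset> X" "p ` X \<noteq> {}" "p ` p ` X \<subseteq> p ` X"
      using psubset.prems by auto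
    then show ?thesis using psubset.IH[of "p ` X"] psubset.prems(1) by (metis dual_order.trans psubset_imp_subset)
  qed
qed

text \<open>The part of a dimer covering on which acyclicity depends. \<open>N\<close> holds the
  lattice points matched to centers. The points off \<open>N\<close> are the impurity ends, and of
  the impurities only the existence of an adjacent point off \<open>N\<close> is kept.\<close>

locale planar_matching =
  fixes m n :: int and N :: "(int \<times> int) set" and c :: "int \<times> int \<Rightarrow> int \<times> int"
  assumes N_grid: "N \<subseteq> grid m n"
    and c_bij: "bij_betw c N (cells m n)"
    and c_corner: "\<And>x. x \<in> N \<Longrightarrow> corner x (c x)"
    and unmatched: "\<And>x. x \<in> grid m n - N \<Longrightarrow> \<exists>y \<in> grid m n - N. adjacent x y"
begin

lemma finite_N: "finite N"
  using N_grid finite_grid by (rule finite_subset)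

definition p :: "int \<times> int \<Rightarrow> int \<times> int" where
  "p x = opp (c x) x"

lemma p_grid: "x \<in> N \<Longrightarrow> p x \<in> grid m n"
  unfolding p_def using bij_betwE[OF c_bij] by (simp add: c_corner opp_in_grid)

lemma colour_p [simp]: "colour (p x) = colour x"
  by (simp add: p_def)

lemma p_neq: "p x \<noteq> x"
  by (simp add: p_def opp_neq)

section \<open>Enclosed sets and their frontiers\<close>

lemma mate_ex: "z \<in> cells m n \<Longrightarrow> \<exists>y\<in>N. c y = z"
  using c_bij by (metis bij_betw_imp_surj_on imageE)

text \<open>Keeping \<open>S\<close> off the boundary ensures that all four squares at a point of
  \<open>S\<close> are squares of the rectangle. Points off \<open>N\<close> may belong to
  \<open>S\<close>; they are the roots in \<open>S\<close>.\<close>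

definition enclosed :: "(int \<times> int) set \<Rightarrow> bool" where
  "enclosed S \<longleftrightarrow> S \<noteq> {} \<and> S \<subseteq> {0<..<m} \<times> {0<..<n} \<and>
     (\<exists>b. \<forall>s\<in>S. colour s = b) \<and> (\<forall>y\<in>N. y \<in> S \<longleftrightarrow> p y \<in> S)"

text \<open>The signs \<open>s\<close> and \<open>t\<close> select one of the four squares at
  \<open>(a, b)\<close>, and the two points compared are the ends of its diagonal that misses
  \<open>(a, b)\<close>. So a frontier point of an enclosed set has the colour that the set does not
  have.\<close>

definition frontier_pts :: "(int \<times> int) set \<Rightarrow> (int \<times> int) set" where
  "frontier_pts S = {(a, b). \<exists>s\<in>{1, -1}. \<exists>t\<in>{1, -1}. ((a + s, b) \<in> S) \<noteq> ((a, b + t) \<in> S)}"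

text \<open>A partner at one of the two separated corners would be sent by \<open>p\<close> to the
  other one, against enclosure. Hence the partner of the square lies on the diagonal through
  \<open>(a, b)\<close>.\<close>

lemma frontier_mate:
  assumes S: "enclosed S" and st: "s \<in> {1, -1}" "t \<in> {1, -1}"
    and sep: "((a + s, b) \<in> S) \<noteq> ((a, b + t) \<in> S)"
  obtains y where "y \<in> N" "c y = (min a (a + s), min b (b + t))" "y = (a, b) \<or> y = (a + s, b + t)"
proof -
  let ?z = "(min a (a + s), min b (b + t))"
  have "?z \<in> cells m n"
    using S st sep by (auto simp: enclosed_def cells_def)
  then obtain y where y: "y \<in> N" "c y = ?z"
    using mate_ex by blast
  then have "corner y ?z"
    using c_corner by metis
  then have "fst y = a \<or> fst y = a + s" "snd y = b \<or> snd y = b + t"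
    using st by (auto simp: corner_def)
  then have "y \<in> {(a, b), (a + s, b), (a, b + t), (a + s, b + t)}"
    by (auto simp: prod_eq_iff)
  moreover have "p (a + s, b) = (a, b + t)" if "y = (a + s, b)"
    using y st that by (auto simp: p_def opp_def)
  moreover have "p (a, b + t) = (a + s, b)" if "y = (a, b + t)"
    using y st that by (auto simp: p_def opp_def)
  moreover have "y \<in> S \<longleftrightarrow> p y \<in> S"
    using S y by (auto simp: enclosed_def)
  ultimately have "y = (a, b) \<or> y = (a + s, b + t)"
    using sep by auto
  with y that show thesis by blast
qed

text \<open>At least two squares at \<open>x\<close> have separated corners, and at most one of them
  is \<open>c x\<close>. In another one the partner is the corner opposite to \<open>x\<close>, so
  its edge leads into \<open>x\<close>.\<close>

lemma frontier_preimage: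
  assumes S: "enclosed S" and x: "x \<in> frontier_pts S"
  shows "\<exists>y \<in> frontier_pts S \<inter> N. p y = x"
proof -
  obtain a b where ab: "x = (a, b)" by (cases x)
  \<comment> \<open>Going once around \<open>x\<close>, membership in \<open>S\<close> changes an even number of times.\<close>
  obtain s t s' t' where st: "s \<in> {1, -1}" "t \<in> {1, -1}" "s' \<in> {1, -1}" "t' \<in> {1, -1::int}"
    and sep: "((a + s, b) \<in> S) \<noteq> ((a, b + t) \<in> S)" "((a + s', b) \<in> S) \<noteq> ((a, b + t') \<in> S)"
    and neq: "(s, t) \<noteq> (s', t')"
  proof -
    have "\<exists>s\<in>{1, -1}. \<exists>t\<in>{1, -1}. ((a + s, b) \<in> S) \<noteq> ((a, b + t) \<in> S)"
      using x ab by (auto simp: frontier_pts_def)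
    then have "\<exists>s\<in>{1, -1}. \<exists>t\<in>{1, -1}. \<exists>s'\<in>{1, -1}. \<exists>t'\<in>{1, -1::int}. ((a + s, b) \<in> S) \<noteq> ((a, b + t) \<in> S)
      \<and> ((a + s', b) \<in> S) \<noteq> ((a, b + t') \<in> S) \<and> (s, t) \<noteq> (s', t')"
      by auto
    then show thesis using that by blast
  qed
  obtain y where y: "y \<in> N" "c y = (min a (a + s), min b (b + t))" "y = (a, b) \<or> y = (a + s, b + t)"
    using frontier_mate[OF S st(1,2) sep(1)] .
  obtain y' where y': "y' \<in> N" "c y' = (min a (a + s'), min b (b + t'))" "y' = (a, b) \<or> y' = (a + s', b + t')"
    using frontier_mate[OF S st(3,4) sep(2)] .
  have "c y \<noteq> c y'"
    using y(2) y'(2) st neq by auto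
  then have "y = (a + s, b + t) \<or> y' = (a + s', b + t')"
    using y(3) y'(3) by auto
  moreover have ?thesis if "u = (a + \<sigma>, b + \<tau>)" "u \<in> N" "c u = (min a (a + \<sigma>), min b (b + \<tau>))"
    "\<sigma> \<in> {1, -1}" "\<tau> \<in> {1, -1}" "((a + \<sigma>, b) \<in> S) \<noteq> ((a, b + \<tau>) \<in> S)" for u \<sigma> \<tau>
  proof -
    have "p u = x"
      using that ab by (auto simp: p_def opp_def)
    \<comment> \<open>Seen from \<open>u\<close>, the same square has the signs -\<sigma> and
      -\<tau>, and the same two corners are compared.\<close>
    moreover have "u \<in> frontier_pts S"
      unfolding frontier_pts_def that(1)
      by (auto intro!: bexI[of _ "-\<sigma>"] bexI[of _ "-\<tau>"]) (use that in auto)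
    ultimately show ?thesis using that by blast
  qed
  ultimately show ?thesis
    using y y' st sep by metis
qed

text \<open>Counting: the frontier is covered by the image of its part in \<open>N\<close>, so this
  part is the whole frontier, and \<open>p\<close> permutes it.\<close>

lemma frontier_invariant:
  assumes S: "enclosed S"
  shows "frontier_pts S \<subseteq> N" "p ` frontier_pts S = frontier_pts S"
proof -
  let ?X = "frontier_pts S"
  have "?X \<subseteq> grid m n"
    using S by (fastforce simp: frontier_pts_def enclosed_def grid_def)
  then have fin: "finite ?X"
    using finite_subset finite_grid by blast
  have sub: "?X \<subseteq> p ` (?X \<inter> N)"
    using frontier_preimage[OF S] by blast
  have "card ?X \<le> card (?X \<inter> N)"
    using fin sub by (meson card_image_le card_mono finite_Int finite_imageI le_trans)
  then have eq: "?X \<inter> N = ?X"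
    using fin by (intro card_seteq) auto
  then show "?X \<subseteq> N" by blast
  have "card (p ` ?X) \<le> card ?X"
    using fin by (rule card_image_le)
  then show "p ` ?X = ?X"
    using card_seteq[of "p ` ?X" ?X] fin sub eq by auto
qed

section \<open>Crossing parity: cycles surround an enclosed set\<close>

text \<open>The membership of a point in the set enclosed by the cycles \<open>Y\<close> is the parity of the number of
  edges of \<open>Y\<close> met by the north-east ray that starts there.\<close>

lemma enclosed_by_invariant:
  assumes Y: "Y \<subseteq> N" "Y \<noteq> {}" "p ` Y = Y" and col: "\<And>y. y \<in> Y \<Longrightarrow> colour y = b"
    and H: "\<And>y. y \<in> Y \<Longrightarrow> snd y \<le> H"
  obtains T where "enclosed T" "\<And>t. t \<in> T \<Longrightarrow> snd t < H"
proof -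
  \<comment> \<open>An edge of \<open>Y\<close> is recorded by the square that it crosses; this
    loses nothing because \<open>c\<close> is injective.\<close>
  define D where "D i j \<longleftrightarrow> (i, j) \<in> c ` Y" for i j
  have YN: "y \<in> N" if "y \<in> Y" for y
    using that Y(1) by blast
  have finY: "finite Y"
    using Y(1) finite_N by (rule finite_subset)
  have injp: "inj_on p Y"
    using finY Y(3) by (simp add: finite_surj_inj eq_card_imp_inj_on)
  have injc: "inj_on c N"
    using c_bij by (rule bij_betw_imp_inj_on)
  have D_cells: "(i, j) \<in> cells m n" if "D i j" for i j
    using that Y(1) bij_betw_imp_surj_on[OF c_bij] unfolding D_def by blast
  \<comment> \<open>Both ends of the diagonal in square \<open>(i, j)\<close> are in
    \<open>Y\<close>, and one of them has height \<open>j + 1\<close>.\<close>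
  have D_H: "j < H" if D: "D i j" for i j
  proof -
    from D obtain y where y: "y \<in> Y" "c y = (i, j)" by (auto simp: D_def)
    have "corner y (i, j)" using c_corner[OF YN[OF y(1)]] y(2) by simp
    moreover have "snd (p y) = 2 * j + 1 - snd y" using y by (simp add: p_def opp_def)
    moreover have "p y \<in> Y" using y Y by blast
    ultimately show ?thesis using H[of y] H[of "p y"] y by (auto simp: corner_def)
  qed
  have D_corner: "v \<in> Y \<and> ((i, j) = c v \<or> (\<exists>u\<in>Y. (i, j) = c u \<and> p u = v))"
    if "D i j" "corner v (i, j)" "colour v = b" for i j v
  proof -
    from that(1) obtain y where y: "y \<in> Y" "c y = (i, j)" by (auto simp: D_def)
    have "corner y (i, j)" using c_corner[OF YN[OF y(1)]] y(2) by simp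
    then have "v = y \<or> v = p y"
      using same_colour_corners[of y "(i, j)" v] that col y by (auto simp: p_def)
    then show ?thesis using y Y(3) by (metis imageI)
  qed
  \<comment> \<open>A point of colour \<open>b\<close> touches no square of \<open>D\<close> if it
    is not in \<open>Y\<close>. Otherwise it touches exactly two, those of its outgoing and its
    incoming edge, which differ by injectivity of \<open>c\<close>.\<close>
  have even_deg: "(D i j \<noteq> D (i - 1) j) \<longleftrightarrow> (D i (j - 1) \<noteq> D (i - 1) (j - 1))"
    if "colour (i, j) = b" for i j
  proof (cases "(i, j) \<in> Y")
    case False
    then show ?thesis using D_corner[of _ _ "(i, j)"] that by (fastforce simp: corner_def)
  next
    case True
    then obtain u where u: "u \<in> Y" "p u = (i, j)" using Y by (metis imageE)
    have ne: "c u \<noteq> c (i, j)"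
      using inj_onD[OF injc, of u "(i, j)"] u True YN p_neq[of u] by auto
    have cor: "corner (i, j) (c (i, j))" "corner (i, j) (c u)"
      using c_corner[OF YN[OF True]] corner_opp[OF c_corner[OF YN[OF u(1)]]] u(2) by (auto simp: p_def)
    have D: "D k l \<longleftrightarrow> (k, l) = c (i, j) \<or> (k, l) = c u" if cor': "corner (i, j) (k, l)" for k l
    proof
      assume "D k l"
      then show "(k, l) = c (i, j) \<or> (k, l) = c u"
        using D_corner[OF _ cor' \<open>colour (i, j) = b\<close>] injp u by (metis inj_onD)
    next
      assume "(k, l) = c (i, j) \<or> (k, l) = c u"
      then show "D k l" using True u by (auto simp: D_def)
    qed
    obtain k l k' l' where kl: "c (i, j) = (k, l)" "c u = (k', l')" by (metis surj_pair)
    have "D i j \<longleftrightarrow> (k = i \<and> l = j) \<or> (k' = i \<and> l' = j)"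
      "D (i - 1) j \<longleftrightarrow> (k = i - 1 \<and> l = j) \<or> (k' = i - 1 \<and> l' = j)"
      "D i (j - 1) \<longleftrightarrow> (k = i \<and> l = j - 1) \<or> (k' = i \<and> l' = j - 1)"
      "D (i - 1) (j - 1) \<longleftrightarrow> (k = i - 1 \<and> l = j - 1) \<or> (k' = i - 1 \<and> l' = j - 1)"
      by (subst D; auto simp: kl corner_def)+
    moreover have "k = i \<or> k = i - 1" "l = j \<or> l = j - 1" "k' = i \<or> k' = i - 1" "l' = j \<or> l' = j - 1"
      using cor kl by (auto simp: corner_def)
    moreover have "k \<noteq> k' \<or> l \<noteq> l'"
      using ne kl by auto
    ultimately show ?thesis by auto
  qed
  \<comment> \<open>From a point not of colour \<open>b\<close> the ray follows diagonals of that
    other colour, so it crosses the edge of each \<open>D\<close> square on its way.\<close>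
  define h where "h i j \<longleftrightarrow> odd (card {k. D (i + int k) (j + int k)})" for i j
  have fin_ray: "finite {k. D (i + int k) (j + int k)}" for i j
    by (rule finite_subset[of _ "{..nat (m - i)}"]) (auto dest!: D_cells simp: cells_def)
  have h_step: "h i j \<longleftrightarrow> (D i j \<noteq> h (i + 1) (j + 1))" for i j
  proof -
    let ?A = "{k. D (i + 1 + int k) (j + 1 + int k)}"
    have "{k. D (i + int k) (j + int k)} = (if D i j then {0} else {}) \<union> Suc ` ?A" (is "?L = ?R")
    proof (rule set_eqI)
      fix k show "k \<in> ?L \<longleftrightarrow> k \<in> ?R"
        by (cases k) (auto simp: algebra_simps)
    qed
    moreover have "card (Suc ` ?A) = card ?A"
      by (rule card_image) simp
    ultimately show ?thesis
      using fin_ray[of "i + 1" "j + 1"] by (auto simp: h_def card_insert_if)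
  qed
  have h_right: "\<not> h i j" if "m \<le> i" for i j
  proof -
    have "{k. D (i + int k) (j + int k)} = {}"
      using that by (auto dest!: D_cells simp: cells_def)
    then show ?thesis by (simp add: h_def)
  qed
  have h_top: "\<not> h i j" if "n \<le> j" for i j
  proof -
    have "{k. D (i + int k) (j + int k)} = {}"
      using that by (auto dest!: D_cells simp: cells_def)
    then show ?thesis by (simp add: h_def)
  qed
  have h_H: "\<not> h i j" if "H \<le> j" for i j
  proof -
    have "{k. D (i + int k) (j + int k)} = {}"
      using that by (auto dest!: D_H)
    then show ?thesis by (simp add: h_def)
  qed
  \<comment> \<open>The two points are the ends of the falling diagonal of square
    \<open>(i - 1, j)\<close>. The induction starts to the right of the rectangle. Its step compares
    this diagonal with its translate by \<open>(1, 1)\<close>, using \<open>even_deg\<close> at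
    \<open>(i, j + 1)\<close>, which lies between the two and has colour \<open>b\<close>.\<close>
  have h_antidiag: "(h i j \<noteq> h (i - 1) (j + 1)) \<longleftrightarrow> D (i - 1) j" if "colour (i, j) \<noteq> b" for i j
    using that
  proof (induction "nat (m + 1 - i)" arbitrary: i j)
    case 0
    then have "\<not> D (i - 1) j" by (auto dest!: D_cells simp: cells_def)
    then show ?case using 0 h_right[of i j] h_right[of "i - 1" "j + 1"] by auto
  next
    case (Suc k)
    have "(h (i + 1) (j + 1) \<noteq> h i (j + 2)) \<longleftrightarrow> D i (j + 1)"
      using Suc.hyps(1)[of "i + 1" "j + 1"] Suc.hyps(2) Suc.prems by (simp add: colour_def add.commute)
    moreover have "h i j \<longleftrightarrow> (D i j \<noteq> h (i + 1) (j + 1))"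
      by (rule h_step)
    moreover have "h (i - 1) (j + 1) \<longleftrightarrow> (D (i - 1) (j + 1) \<noteq> h i (j + 2))"
      using h_step[of "i - 1" "j + 1"] by (simp add: algebra_simps)
    moreover have "(D i (j + 1) \<noteq> D (i - 1) (j + 1)) \<longleftrightarrow> (D i j \<noteq> D (i - 1) j)"
      using even_deg[of i "j + 1"] Suc.prems by (auto simp: colour_def)
    ultimately show ?case by argo
  qed
  \<comment> \<open>Walking north-west to the left of the rectangle meets no square of
    \<open>D\<close>, so the parity is the one above the top. For \<open>h_bottom\<close> the walk
    goes south-east below the rectangle.\<close>
  have h_left: "\<not> h i j" if "i \<le> 0" "colour (i, j) \<noteq> b" for i j
    using that
  proof (induction "nat (n - j)" arbitrary: i j)
    case 0
    then show ?case using h_top by simp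
  next
    case (Suc k)
    have "\<not> D (i - 1) j" using Suc.prems by (auto dest!: D_cells simp: cells_def)
    moreover have "\<not> h (i - 1) (j + 1)"
      using Suc.hyps(1)[of "j + 1" "i - 1"] Suc.hyps(2) Suc.prems by (simp add: colour_def)
    ultimately show ?case using h_antidiag Suc.prems by blast
  qed
  have h_bottom: "\<not> h i j" if "j \<le> 0" "colour (i, j) \<noteq> b" for i j
    using that
  proof (induction "nat (m - i)" arbitrary: i j)
    case 0
    then show ?case using h_right by simp
  next
    case (Suc k)
    have "\<not> D i (j - 1)" using Suc.prems by (auto dest!: D_cells simp: cells_def)
    moreover have "\<not> h (i + 1) (j - 1)"
      using Suc.hyps(1)[of "i + 1" "j - 1"] Suc.hyps(2) Suc.prems by (simp add: colour_def)
    moreover have "colour (i + 1, j - 1) \<noteq> b"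
      using Suc.prems by (simp add: colour_def)
    ultimately show ?case using h_antidiag[of "i + 1" "j - 1"] by simp
  qed
  define T where "T = {x. colour x \<noteq> b \<and> h (fst x) (snd x)}"
  have T_iff: "x \<in> T \<longleftrightarrow> opp (i, j) x \<in> T" if "\<not> D i j" "corner x (i, j)" for x i j
  proof (cases "colour x = b")
    case True
    then show ?thesis by (auto simp: T_def)
  next
    case False
    have 1: "h i j \<longleftrightarrow> h (i + 1) (j + 1)"
      using h_step[of i j] that by simp
    have 2: "h (i + 1) j \<longleftrightarrow> h i (j + 1)" if "colour (i + 1, j) \<noteq> b"
      using h_antidiag[OF that] \<open>\<not> D i j\<close> by simp
    have "colour (i, j) \<noteq> b \<longleftrightarrow> colour (i + 1, j + 1) \<noteq> b" "colour (i + 1, j) \<noteq> b \<longleftrightarrow> colour (i, j + 1) \<noteq> b"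
      by (auto simp: colour_def)
    then show ?thesis
      using that(2) False 1 2
      by (cases x) (auto simp: corner_def opp_def T_def)
  qed
  have "enclosed T"
    unfolding enclosed_def
  proof (intro conjI ballI)
    obtain y where y: "y \<in> Y" using Y by blast
    obtain i j where ij: "c y = (i, j)" by (cases "c y")
    have D: "D i j" using y ij by (force simp: D_def)
    \<comment> \<open>The two corners of a \<open>D\<close> square that do not have colour
      \<open>b\<close> have different parities, so one of them is in \<open>T\<close>.\<close>
    show "T \<noteq> {}"
    proof (cases "colour (i, j) = b")
      case True
      then have ncol: "colour (i + 1, j) \<noteq> b" "colour (i, j + 1) \<noteq> b" by (auto simp: colour_def)
      then have "h (i + 1) j \<or> h i (j + 1)" using h_antidiag[of "i + 1" j] D by auto
      then show ?thesis using ncol by (auto simp: T_def)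
    next
      case False
      moreover from False have "colour (i + 1, j + 1) \<noteq> b" by (auto simp: colour_def)
      moreover have "h i j \<or> h (i + 1) (j + 1)" using h_step[of i j] D by auto
      ultimately show ?thesis by (auto simp: T_def)
    qed
  next
    show "T \<subseteq> {0<..<m} \<times> {0<..<n}"
      unfolding T_def using h_left h_right h_top h_bottom by (fastforce simp: not_le[symmetric])
  next
    show "\<exists>b. \<forall>s\<in>T. colour s = b"
      by (rule exI[of _ "\<not> b"]) (auto simp: T_def)
  next
    fix y assume y: "y \<in> N"
    obtain i j where ij: "c y = (i, j)" by (cases "c y")
    show "y \<in> T \<longleftrightarrow> p y \<in> T"
    proof (cases "D i j")
      case True
      then obtain y' where "y' \<in> Y" "c y' = c y" using ij by (auto simp: D_def)
      then have "y \<in> Y" using inj_onD[OF injc, of y' y] y YN by metis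
      then have "colour y = b" "colour (p y) = b" using col by auto
      then show ?thesis by (auto simp: T_def)
    next
      case False
      then show ?thesis using T_iff[OF False, of y] c_corner[OF y] ij by (simp add: p_def)
    qed
  qed
  moreover have "snd t < H" if "t \<in> T" for t
    using that h_H by (auto simp: T_def not_le[symmetric])
  ultimately show thesis using that by blast
qed

text \<open>The points whose path along \<open>p\<close> reaches \<open>a\<close>. For
  \<open>a\<close> outside \<open>N\<close> this is the tree with root \<open>a\<close>.\<close>

inductive_set basin :: "int \<times> int \<Rightarrow> (int \<times> int) set" for a where
  root: "a \<in> basin a"
| step: "x \<in> N \<Longrightarrow> p x \<in> basin a \<Longrightarrow> x \<in> basin a"

text \<open>Without a root in \<open>S\<close>, the map \<open>p\<close> sends \<open>S\<close> into
  itself and so has cycles there, which surround an enclosed set. A root \<open>r\<close> in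
  \<open>S\<close> has an adjacent root \<open>a\<close>; the frontier consists of cycles, so the
  tree of \<open>a\<close> cannot meet it and stays strictly inside.\<close>

lemma enclosed_below:
  assumes S: "enclosed S" and H: "\<And>s. s \<in> S \<Longrightarrow> snd s \<le> H"
  obtains T where "enclosed T" "\<And>t. t \<in> T \<Longrightarrow> snd t < H"
proof (cases "S \<subseteq> N")
  case True
  have "p ` S \<subseteq> S" "S \<noteq> {}" using S True by (auto simp: enclosed_def)
  moreover have "finite S" using True finite_N by (rule finite_subset)
  ultimately obtain Y where Y: "Y \<subseteq> S" "Y \<noteq> {}" "p ` Y = Y"
    using invariant_core by metis
  obtain b where "\<forall>s\<in>S. colour s = b" using S by (auto simp: enclosed_def)
  then show thesis
    using enclosed_by_invariant[of Y b H] Y True H that by blast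
next
  case False
  then obtain r where r: "r \<in> S" "r \<notin> N" by blast
  have int: "S \<subseteq> {0<..<m} \<times> {0<..<n}" using S by (auto simp: enclosed_def)
  obtain a where a: "a \<in> grid m n" "a \<notin> N" "adjacent r a"
    using unmatched[of r] r int by (fastforce simp: grid_def)
  let ?X = "frontier_pts S"
  \<comment> \<open>Off the frontier every horizontal neighbour agrees with every vertical one about
    membership in \<open>S\<close>, so one neighbour in \<open>S\<close> forces all four.\<close>
  have nbrs: "(i + 1, j) \<in> S \<and> (i - 1, j) \<in> S \<and> (i, j + 1) \<in> S \<and> (i, j - 1) \<in> S"
    if "(i, j) \<notin> ?X" "s \<in> S" "adjacent (i, j) s" for i j s
  proof -
    have "s = (i + 1, j) \<or> s = (i - 1, j) \<or> s = (i, j + 1) \<or> s = (i, j - 1)"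
      using that(3) by (cases s) (auto simp: adjacent_def)
    then show ?thesis using that(1,2) by (auto simp: frontier_pts_def)
  qed
  \<comment> \<open>The frontier lies in \<open>N\<close> and is closed under \<open>p\<close>, so
    no path from it arrives at the root \<open>a\<close>.\<close>
  have disj: "t \<notin> ?X" if "t \<in> basin a" for t
    using that
  proof induction
    case root
    then show ?case using frontier_invariant(1)[OF S] a by blast
  next
    case (step x)
    then show ?case using frontier_invariant(2)[OF S] by blast
  qed
  have touch: "\<exists>s\<in>S. adjacent t s" if "t \<in> basin a" for t
    using that
  proof induction
    case root
    then show ?case using r a by (auto simp: adjacent_def abs_minus_commute)
  next
    case (step x)
    obtain i j where ij: "p x = (i, j)" by (cases "p x")
    have nb: "(i + 1, j) \<in> S" "(i - 1, j) \<in> S"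
      using step ij nbrs disj by metis+
    have "corner x (c x)" "(i, j) = opp (c x) x"
      using c_corner step.hyps(1) ij by (auto simp: p_def)
    \<comment> \<open>The points \<open>x\<close> and \<open>p x\<close> are opposite corners of a
      square, so a horizontal neighbour of \<open>p x\<close> is a vertical neighbour of
      \<open>x\<close>.\<close>
    then have "adjacent x (i + 1, j) \<or> adjacent x (i - 1, j)"
      by (cases x; cases "c x") (auto simp: corner_def opp_def adjacent_def)
    then show ?case using nb by blast
  qed
  have all: "(i + 1, j) \<in> S \<and> (i - 1, j) \<in> S \<and> (i, j + 1) \<in> S \<and> (i, j - 1) \<in> S"
    if "(i, j) \<in> basin a" for i j
    using touch[OF that] disj[OF that] nbrs by blast
  have "enclosed (basin a)"
    unfolding enclosed_def
  proof (intro conjI ballI)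
    show "basin a \<noteq> {}" using basin.root by blast
    show "basin a \<subseteq> {0<..<m} \<times> {0<..<n}"
      using all int by fastforce
    have "colour t = colour a" if "t \<in> basin a" for t
      using that by induction auto
    then show "\<exists>b. \<forall>s\<in>basin a. colour s = b" by blast
    fix y assume "y \<in> N"
    then show "y \<in> basin a \<longleftrightarrow> p y \<in> basin a"
      using a by (metis basin.cases basin.step)
  qed
  \<comment> \<open>The point right above \<open>t\<close> is in \<open>S\<close>, which makes the
    inequality strict.\<close>
  moreover have "snd t < H" if "t \<in> basin a" for t
    using all[of "fst t" "snd t"] that H by fastforce
  ultimately show thesis using that by blast
qed

text \<open>\<open>enclosed_below\<close> lowers an integer height bound by one each time, while all
  heights in the open rectangle are positive.\<close>

lemma not_enclosed: "\<not> enclosed S"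
proof
  assume "enclosed S"
  moreover have "\<forall>s\<in>S. snd s \<le> int (nat n)" using \<open>enclosed S\<close> by (force simp: enclosed_def)
  moreover have "\<not> (enclosed S \<and> (\<forall>s\<in>S. snd s \<le> int k))" for k S
  proof (induction k arbitrary: S)
    case 0
    then show ?case by (force simp: enclosed_def)
  next
    case (Suc k)
    show ?case
    proof
      assume "enclosed S \<and> (\<forall>s\<in>S. snd s \<le> int (Suc k))"
      then obtain T where "enclosed T" "\<And>t. t \<in> T \<Longrightarrow> snd t < int (Suc k)"
        using enclosed_below by metis
      then show False using Suc.IH[of T] by fastforce
    qed
  qed
  ultimately show False by blast
qed

text \<open>A nonempty set without minimal element lies in \<open>N\<close> and is mapped into
  itself by \<open>p\<close>. Its points of one colour then contain cycles, which would surround an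
  enclosed set.\<close>

theorem wf_p: "wf {(p x, x) | x. x \<in> N}"
proof (rule wfI_min)
  fix x :: "int \<times> int" and Q assume "x \<in> Q"
  show "\<exists>z\<in>Q. \<forall>y. (y, z) \<in> {(p x, x) |x. x \<in> N} \<longrightarrow> y \<notin> Q"
  proof (rule ccontr)
    assume "\<not> ?thesis"
    then have cl: "z \<in> N \<and> p z \<in> Q" if "z \<in> Q" for z using that by blast
    define X where "X = {z \<in> Q. colour z = colour x}"
    have "X \<subseteq> N" "X \<noteq> {}" "p ` X \<subseteq> X" using cl \<open>x \<in> Q\<close> unfolding X_def by (blast, blast, auto)
    moreover from this(1) have "finite X" using finite_N by (rule finite_subset)
    ultimately obtain Y where Y: "Y \<subseteq> X" "Y \<noteq> {}" "p ` Y = Y"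
      using invariant_core by metis
    have "Y \<subseteq> N" using Y \<open>X \<subseteq> N\<close> by blast
    moreover have "snd y \<le> n" if "y \<in> Y" for y
      using that \<open>Y \<subseteq> N\<close> N_grid by (fastforce simp: grid_def)
    moreover have "colour y = colour x" if "y \<in> Y" for y using that Y by (auto simp: X_def)
    ultimately show False
      using enclosed_by_invariant[of Y "colour x" n] Y not_enclosed by metis
  qed
qed

end

section \<open>Functional forests\<close>

lemma functional_forest_acyclic:
  assumes fin: "finite N" and wf: "wf {(p v, v) | v. v \<in> N}"
    and E: "edges F \<subseteq> {{v, p v} | v. v \<in> N}"
  shows "\<not> is_cycle F c"
proof
  assume cyc: "is_cycle F c"
  let ?L = "length c"
  have L: "?L \<ge> 3" and dist: "distinct c" and edge: "\<And>i. i < ?L \<Longrightarrow> {c ! i, c ! (Suc i mod ?L)} \<in> edges F"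
    using cyc by (auto simp: is_cycle_def)
  \<comment> \<open>By finiteness the converse relation is well founded too. A minimal vertex for it
    on the cycle is not the image under \<open>p\<close> of any vertex of \<open>N\<close> on the
    cycle.\<close>
  have "finite {(p v, v) | v. v \<in> N}"
    using fin by simp
  then have "wf ({(p v, v) | v. v \<in> N}\<inverse>)"
    using wf finite_acyclic_wf_converse wf_acyclic by blast
  moreover have "hd c \<in> set c"
    using L by (cases c) auto
  ultimately have "\<exists>v\<in>set c. \<forall>u. (u, v) \<in> {(p v, v) | v. v \<in> N}\<inverse> \<longrightarrow> u \<notin> set c"
    unfolding wf_eq_minimal by (elim allE[of _ "set c"]) (rule mp, blast+)
  then obtain v where v: "v \<in> set c"
    and top: "\<And>u. (u, v) \<in> {(p v, v) | v. v \<in> N}\<inverse> \<Longrightarrow> u \<notin> set c"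
    by blast
  \<comment> \<open>\<open>v\<close> is a vertex of the cycle farthest from its root, so both its neighbours are \<open>p v\<close>.\<close>
  have nbr: "w = p v" if vw: "{v, w} \<in> edges F" "w \<in> set c" for w
  proof -
    obtain u where u: "u \<in> N" "{v, w} = {u, p u}"
      using E vw(1) by blast
    have "\<not> (u = w \<and> p u = v)"
      using top[of w] vw(2) u by auto
    then show ?thesis
      using u(2) by (auto simp: doubleton_eq_iff)
  qed
  obtain i where i: "i < ?L" "c ! i = v"
    using v by (auto simp: in_set_conv_nth)
  \<comment> \<open>The predecessor and the successor of position \<open>i\<close> on the cycle;
    they differ because the length is at least 3.\<close>
  define j where "j = (if i = 0 then ?L - 1 else i - 1)"
  define k where "k = (if i = ?L - 1 then 0 else Suc i)"
  have "Suc (?L - 1) = ?L"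
    using L by linarith
  then have jk: "j < ?L" "k < ?L" "j \<noteq> k" "Suc j mod ?L = i" "Suc i mod ?L = k"
    using i L by (auto simp: j_def k_def)
  have "c ! k = p v"
    using nbr[of "c ! k"] edge[OF i(1)] i jk by simp
  moreover have "c ! j = p v"
    using nbr[of "c ! j"] edge[OF jk(1)] i jk by (simp add: insert_commute)
  ultimately show False
    using jk(1-3) nth_eq_iff_index_eq[OF dist jk(1,2)] by simp
qed

lemma component_of:
  assumes "v \<in> verts F"
  shows "reachable F `` {v} \<in> conn_components F" "v \<in> reachable F `` {v}"
  using assms by (auto simp: conn_components_def quotient_def reachable_def)

text \<open>\<rho> sends a point to the place where iterating \<open>p\<close> stops. It exists by
  well-foundedness, and it is unique because each point of \<open>N\<close> has only one
  successor.\<close>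

lemma functional_forest_root:
  assumes wf: "wf {(p v, v) | v. v \<in> N}" and NW: "N \<subseteq> W" "p ` N \<subseteq> W"
  shows "\<exists>\<rho>. (\<forall>v\<in>W. \<rho> v \<in> W - N \<and> (v, \<rho> v) \<in> {(v, p v) | v. v \<in> N}\<^sup>*) \<and>
    (\<forall>v\<in>W - N. \<rho> v = v) \<and> (\<forall>v\<in>N. \<rho> v = \<rho> (p v))"
proof -
  define s where "s = {(v, p v) | v. v \<in> N}"
  define \<rho> where "\<rho> v = (THE r. r \<in> W - N \<and> (v, r) \<in> s\<^sup>*)" for v
  have stop: "r = v" if "(v, r) \<in> s\<^sup>*" "v \<notin> N" for v r
    using that by (auto simp: s_def elim: converse_rtranclE)
  have step: "(v, r) \<in> s\<^sup>* \<longleftrightarrow> r = v \<or> (p v, r) \<in> s\<^sup>*" if "v \<in> N" for v r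
  proof
    assume "(v, r) \<in> s\<^sup>*"
    then show "r = v \<or> (p v, r) \<in> s\<^sup>*" by (auto simp: s_def elim: converse_rtranclE)
  next
    have "(v, p v) \<in> s" using that by (auto simp: s_def)
    then show "r = v \<or> (p v, r) \<in> s\<^sup>* \<Longrightarrow> (v, r) \<in> s\<^sup>*" by (auto intro: converse_rtrancl_into_rtrancl)
  qed
  have "v \<in> W \<longrightarrow> (\<exists>!r. r \<in> W - N \<and> (v, r) \<in> s\<^sup>*)" for v
    using wf
  proof (induction v rule: wf_induct_rule)
    case (less v)
    show ?case
    proof (cases "v \<in> N")
      case True
      then have "p v \<in> W" "(p v, v) \<in> {(p v, v) | v. v \<in> N}" using NW by auto
      then have "\<exists>!r. r \<in> W - N \<and> (p v, r) \<in> s\<^sup>*" using less by blast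
      moreover have "r \<in> W - N \<and> (v, r) \<in> s\<^sup>* \<longleftrightarrow> r \<in> W - N \<and> (p v, r) \<in> s\<^sup>*" for r
        using step[OF True, of r] True by auto
      ultimately show ?thesis by simp
    next
      case False
      show ?thesis
      proof (intro impI ex1I[of _ v])
        show "v \<in> W \<Longrightarrow> v \<in> W - N \<and> (v, v) \<in> s\<^sup>*" using False by simp
        show "r \<in> W - N \<and> (v, r) \<in> s\<^sup>* \<Longrightarrow> r = v" for r using stop[of v r] False by simp
      qed
    qed
  qed
  then have ex1: "\<exists>!r. r \<in> W - N \<and> (v, r) \<in> s\<^sup>*" if "v \<in> W" for v
    using that by blast
  have \<rho>: "\<rho> v \<in> W - N \<and> (v, \<rho> v) \<in> s\<^sup>*" if "v \<in> W" for v
    unfolding \<rho>_def by (rule theI'[OF ex1[OF that]])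
  have "\<rho> v = \<rho> (p v)" if "v \<in> N" for v
  proof -
    have "v \<in> W" "p v \<in> W" using that NW by auto
    then show ?thesis using \<rho>[of v] \<rho>[of "p v"] ex1[of v] step[OF that] by metis
  qed
  moreover have "\<rho> v = v" if "v \<in> W - N" for v
    using stop[of v "\<rho> v"] \<rho>[of v] that by blast
  ultimately show ?thesis
    using \<rho> unfolding s_def by (intro exI[of _ \<rho>]) simp
qed

text \<open>The root map \<rho> is constant along edges, and every vertex is joined to its root. So
  the components are the fibres of \<rho>, one for each root.\<close>

lemma functional_forest_components:
  assumes wf: "wf {(p v, v) | v. v \<in> N}" and NW: "N \<subseteq> W" "p ` N \<subseteq> W"
    and V: "verts F = W" and E: "edges F = {{v, p v} | v. v \<in> N}"
  shows "\<And>T. T \<in> conn_components F \<Longrightarrow> \<exists>!r. r \<in> W - N \<and> r \<in> T"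
    and "card (conn_components F) = card (W - N)"
proof -
  obtain \<rho> where \<rho>: "\<And>v. v \<in> W \<Longrightarrow> \<rho> v \<in> W - N" "\<And>v. v \<in> W - N \<Longrightarrow> \<rho> v = v"
    "\<And>v. v \<in> N \<Longrightarrow> \<rho> v = \<rho> (p v)" "\<And>v. v \<in> W \<Longrightarrow> (v, \<rho> v) \<in> {(v, p v) | v. v \<in> N}\<^sup>*"
    using functional_forest_root[OF wf NW] by auto
  let ?A = "{(x, y). {x, y} \<in> edges F}"
  have sym: "sym (?A\<^sup>*)"
    by (rule sym_rtrancl) (auto simp: sym_def insert_commute)
  have up: "(v, \<rho> v) \<in> ?A\<^sup>*" if "v \<in> W" for v
  proof -
    have "{(v, p v) | v. v \<in> N} \<subseteq> ?A" using E by auto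
    then show ?thesis by (rule subsetD[OF rtrancl_mono \<rho>(4)[OF that]])
  qed
  have same: "\<rho> u = \<rho> v" if "(u, v) \<in> ?A\<^sup>*" for u v
    using that
  proof induction
    case (step y z)
    then have "{y, z} \<in> edges F" by simp
    then obtain w where "w \<in> N" "{y, z} = {w, p w}" using E by auto
    then have "\<rho> y = \<rho> z" using \<rho>(3)[of w] by (auto simp: doubleton_eq_iff)
    then show ?case using step by simp
  qed simp
  have reach: "(u, v) \<in> reachable F \<longleftrightarrow> u \<in> W \<and> v \<in> W \<and> \<rho> u = \<rho> v" for u v
  proof
    assume "(u, v) \<in> reachable F"
    then show "u \<in> W \<and> v \<in> W \<and> \<rho> u = \<rho> v" using same V by (auto simp: reachable_def)
  next
    assume uv: "u \<in> W \<and> v \<in> W \<and> \<rho> u = \<rho> v"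
    then have "(u, \<rho> u) \<in> ?A\<^sup>*" "(\<rho> u, v) \<in> ?A\<^sup>*" using up[of u] up[of v] sym by (auto dest: symD)
    then show "(u, v) \<in> reachable F" using uv V by (auto simp: reachable_def)
  qed
  let ?C = "\<lambda>r. reachable F `` {r}"
  have C: "?C u = {v \<in> W. \<rho> v = \<rho> u}" if "u \<in> W" for u
    using that reach by auto
  show "\<exists>!r. r \<in> W - N \<and> r \<in> T" if T: "T \<in> conn_components F" for T
  proof -
    obtain u where u: "u \<in> W" "T = {v \<in> W. \<rho> v = \<rho> u}"
      using T C V by (auto simp: conn_components_def quotient_def)
    show ?thesis
      by (rule ex1I[of _ "\<rho> u"]) (use u \<rho>(1)[of u] \<rho>(2) in auto)
  qed
  have "conn_components F = ?C ` (W - N)"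
  proof (intro equalityI subsetI)
    fix T assume "T \<in> conn_components F"
    then obtain u where u: "u \<in> W" "T = ?C u"
      using V by (auto simp: conn_components_def quotient_def)
    moreover have "?C u = ?C (\<rho> u)"
      using u C \<rho>(1)[of u] \<rho>(2)[of "\<rho> u"] by simp
    ultimately show "T \<in> ?C ` (W - N)" using \<rho>(1)[of u] by auto
  next
    fix T assume "T \<in> ?C ` (W - N)"
    then show "T \<in> conn_components F" using V by (auto simp: conn_components_def quotient_def)
  qed
  moreover have "inj_on ?C (W - N)"
  proof (rule inj_onI)
    fix r r' assume r: "r \<in> W - N" "r' \<in> W - N" and eq: "?C r = ?C r'"
    have "r \<in> ?C r" using r C by auto
    then have "\<rho> r = \<rho> r'" using eq C r by auto
    then show "r = r'" using r \<rho>(2) by metis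
  qed
  ultimately show "card (conn_components F) = card (W - N)"
    by (simp add: card_image)
qed

text \<open>\<open>d\<close> is the distance to \<open>R\<close> in the graph; \<open>p\<close>
  picks a neighbour that is closer to \<open>R\<close>, so \<open>d\<close> decreases along
  \<open>p\<close>.\<close>

lemma orientation_towards_roots:
  assumes V: "verts F = W" and comp: "\<And>T. T \<in> conn_components F \<Longrightarrow> \<exists>r. r \<in> R \<and> r \<in> T"
  shows "\<exists>p. (\<forall>v\<in>W - R. {v, p v} \<in> edges F) \<and> wf {(p v, v) | v. v \<in> W - R}"
proof -
  let ?A = "{(x, y). {x, y} \<in> edges F}"
  define d where "d v = (LEAST i. \<exists>r\<in>R. (v, r) \<in> ?A ^^ i)" for v
  have closer: "\<exists>w. {v, w} \<in> edges F \<and> d w < d v" if v: "v \<in> W - R" for v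
  proof -
    have "\<exists>r\<in>R. (v, r) \<in> ?A\<^sup>*"
      using comp[OF component_of(1), of v] v V by (auto simp: reachable_def)
    then have "\<exists>i. \<exists>r\<in>R. (v, r) \<in> ?A ^^ i"
      by (meson rtrancl_imp_relpow)
    then have "\<exists>r\<in>R. (v, r) \<in> ?A ^^ d v"
      unfolding d_def by (rule LeastI_ex)
    then obtain r where r: "r \<in> R" "(v, r) \<in> ?A ^^ d v" by blast
    then have "d v \<noteq> 0" using v by (metis DiffD2 relpow_0_E)
    then obtain k where k: "d v = Suc k" using not0_implies_Suc by blast
    then obtain w where w: "(v, w) \<in> ?A" "(w, r) \<in> ?A ^^ k"
      using r(2) by (metis relpow_Suc_E2)
    have "d w \<le> k"
      unfolding d_def by (rule Least_le) (use w r in blast)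
    then show ?thesis using w k by auto
  qed
  then obtain p where p: "\<And>v. v \<in> W - R \<Longrightarrow> {v, p v} \<in> edges F \<and> d (p v) < d v"
    by metis
  moreover have "wf {(p v, v) | v. v \<in> W - R}"
    by (rule wf_subset[OF wf_measure[of d]]) (use p in auto)
  ultimately show ?thesis by blast
qed

section \<open>Integer coordinates\<close>

definition lattice_pt :: "int \<times> int \<Rightarrow> point" where
  "lattice_pt x = (of_int (fst x), of_int (snd x))"

definition centre_pt :: "int \<times> int \<Rightarrow> point" where
  "centre_pt z = (of_int (fst z) + 1/2, of_int (snd z) + 1/2)"

text \<open>The boolean index lets one argument serve both forests: \<open>True\<close> stands for
  \<open>V1\<close> and \<open>False\<close> for \<open>V2\<close>.\<close>

definition colour_class :: "bool \<Rightarrow> point set" where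
  "colour_class b = (if b then V1 else V2)"

text \<open>Described by its square and its colour, without a starting point: the same edge arises
  from either orientation.\<close>

definition diagonal :: "bool \<Rightarrow> int \<times> int \<Rightarrow> point set" where
  "diagonal b z = lattice_pt ` {x. corner x z \<and> colour x = b}"

lemma lattice_pt_eq_iff [simp]: "lattice_pt x = lattice_pt y \<longleftrightarrow> x = y"
  by (auto simp: lattice_pt_def prod_eq_iff)

lemma centre_pt_eq_iff [simp]: "centre_pt x = centre_pt y \<longleftrightarrow> x = y"
  by (auto simp: centre_pt_def prod_eq_iff)

lemma lattice_neq_centre [simp]: "lattice_pt x \<noteq> centre_pt z" "centre_pt z \<noteq> lattice_pt x"
proof -
  have "fst (lattice_pt x) \<noteq> fst (centre_pt z)"
  proof
    assume "fst (lattice_pt x) = fst (centre_pt z)"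
    then have "real_of_int (2 * fst x) = real_of_int (2 * fst z + 1)"
      by (simp add: lattice_pt_def centre_pt_def)
    then have "2 * fst x = 2 * fst z + 1"
      by (simp only: of_int_eq_iff)
    then show False by presburger
  qed
  then show "lattice_pt x \<noteq> centre_pt z" "centre_pt z \<noteq> lattice_pt x" by auto
qed

lemma int_lattice_eq: "int_lattice = range lattice_pt"
  by (auto simp: int_lattice_def lattice_pt_def image_def)

lemma V3_eq: "V3 = range centre_pt"
  by (auto simp: V3_def centre_pt_def image_def)

lemma colour_class_eq: "colour_class b = lattice_pt ` {x. colour x = b}"
  by (auto simp: colour_class_def V1_def V2_def lattice_pt_def colour_def image_def)

section \<open>Adjacency as integer arithmetic\<close>

lemma near_iff: "near u v \<longleftrightarrow> (fst u - fst v)\<^sup>2 + (snd u - snd v)\<^sup>2 \<in> {1, 1/2}"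
proof -
  have "dist u v = sqrt ((fst u - fst v)\<^sup>2 + (snd u - snd v)\<^sup>2)"
    by (simp add: dist_prod_def dist_real_def)
  moreover have "sqrt 2 / 2 = sqrt (1/2)"
    by (simp add: real_sqrt_divide field_simps)
  ultimately show ?thesis
    unfolding near_def by (metis insert_iff real_sqrt_eq_iff real_sqrt_one singleton_iff)
qed

lemma near_lattice_iff: "near (lattice_pt x) (lattice_pt y) \<longleftrightarrow> adjacent x y"
proof -
  let ?i = "fst x - fst y" and ?j = "snd x - snd y"
  have "near (lattice_pt x) (lattice_pt y) \<longleftrightarrow> real_of_int (?i\<^sup>2 + ?j\<^sup>2) \<in> {1, 1/2}"
    by (simp add: near_iff lattice_pt_def)
  also have "\<dots> \<longleftrightarrow> real_of_int (?i\<^sup>2 + ?j\<^sup>2) = real_of_int 1 \<or> real_of_int (2 * (?i\<^sup>2 + ?j\<^sup>2)) = real_of_int 1"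
    by auto
  also have "\<dots> \<longleftrightarrow> ?i\<^sup>2 + ?j\<^sup>2 = 1 \<or> 2 * (?i\<^sup>2 + ?j\<^sup>2) = 1"
    by (simp only: of_int_eq_iff)
  \<comment> \<open>The distance \<open>sqrt 2 / 2\<close> would make twice an integer equal to
    1.\<close>
  also have "\<dots> \<longleftrightarrow> ?i\<^sup>2 + ?j\<^sup>2 = 1"
    by presburger
  also have "\<dots> \<longleftrightarrow> adjacent x y"
  proof
    assume *: "?i\<^sup>2 + ?j\<^sup>2 = 1"
    have "\<bar>k\<bar> \<le> k\<^sup>2" for k :: int
      using self_le_power[of "\<bar>k\<bar>" 2] by (cases "k = 0") auto
    then have "\<bar>?i\<bar> \<le> ?i\<^sup>2" "\<bar>?j\<bar> \<le> ?j\<^sup>2"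
      by blast+
    moreover have "?i \<noteq> 0 \<or> ?j \<noteq> 0" using * by auto
    ultimately show "adjacent x y" using * unfolding adjacent_def by linarith
  next
    assume "adjacent x y"
    then have "?i = 1 \<and> ?j = 0 \<or> ?i = -1 \<and> ?j = 0 \<or> ?i = 0 \<and> ?j = 1 \<or> ?i = 0 \<and> ?j = -1"
      unfolding adjacent_def by linarith
    then show "?i\<^sup>2 + ?j\<^sup>2 = 1"
      by (elim disjE conjE) (simp_all only: power2_minus one_power2 zero_power2)
  qed
  finally show ?thesis .
qed

text \<open>With integer offsets \<open>i\<close> and \<open>j\<close> the squared distance is
  \<open>i * (i - 1) + j * (j - 1) + 1/2\<close>. The value 1 fails by integrality, and 1/2 forces
  both nonnegative products to vanish.\<close>

lemma near_centre_iff: "near (lattice_pt x) (centre_pt z) \<longleftrightarrow> corner x z"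
proof -
  let ?i = "fst x - fst z" and ?j = "snd x - snd z"
  have eq: "(real_of_int (fst x) - (real_of_int (fst z) + 1/2))\<^sup>2 + (real_of_int (snd x) - (real_of_int (snd z) + 1/2))\<^sup>2
    = real_of_int (?i * (?i - 1) + ?j * (?j - 1)) + 1/2"
    by (simp add: power2_eq_square algebra_simps)
  have ev: "even (?i * (?i - 1))" "even (?j * (?j - 1))" by auto
  have pos: "k * (k - 1) \<ge> 0" "k * (k - 1) = 0 \<longleftrightarrow> k = 0 \<or> k = 1" for k :: int
    by (auto simp: zero_le_mult_iff)
  have "near (lattice_pt x) (centre_pt z) \<longleftrightarrow> real_of_int (?i * (?i - 1) + ?j * (?j - 1)) + 1/2 \<in> {1, 1/2}"
    unfolding near_iff eq[symmetric] by (simp add: lattice_pt_def centre_pt_def)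
  also have "\<dots> \<longleftrightarrow> real_of_int (2 * (?i * (?i - 1) + ?j * (?j - 1))) = real_of_int 1 \<or>
      real_of_int (?i * (?i - 1) + ?j * (?j - 1)) = real_of_int 0"
    by auto
  also have "\<dots> \<longleftrightarrow> 2 * (?i * (?i - 1) + ?j * (?j - 1)) = 1 \<or> ?i * (?i - 1) + ?j * (?j - 1) = 0"
    by (simp only: of_int_eq_iff)
  also have "\<dots> \<longleftrightarrow> ?i * (?i - 1) = 0 \<and> ?j * (?j - 1) = 0"
    using pos(1)[of ?i] pos(1)[of ?j] by presburger
  also have "\<dots> \<longleftrightarrow> corner x z"
    unfolding pos(2) by (auto simp: corner_def)
  finally show ?thesis .
qed

lemma E1_iff: "e \<in> E1 \<longleftrightarrow> (\<exists>x z. corner x z \<and> e = {lattice_pt x, centre_pt z})"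
  unfolding E1_def int_lattice_eq V3_eq near_centre_iff[symmetric] by blast

lemma E2_iff: "e \<in> E2 \<longleftrightarrow> (\<exists>x y. adjacent x y \<and> e = {lattice_pt x, lattice_pt y})"
  unfolding E2_def int_lattice_eq near_lattice_iff[symmetric] by blast

lemma lattice_centre_notin_E2 [simp]: "{lattice_pt x, centre_pt z} \<notin> E2"
  by (auto simp: E2_iff doubleton_eq_iff)

lemma colour_adjacent: "adjacent x y \<Longrightarrow> colour y \<longleftrightarrow> \<not> colour x"
  unfolding adjacent_def colour_def by presburger

lemma rect_region:
  "{(of_int x, of_int y) | x y :: int. 0 \<le> x \<and> x \<le> int m \<and> 0 \<le> y \<and> y \<le> int n} \<union>
   {(of_int x + 1/2, of_int y + 1/2) | x y :: int. 0 \<le> x \<and> x \<le> int m - 1 \<and> 0 \<le> y \<and> y \<le> int n - 1}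
   = lattice_pt ` grid (int m) (int n) \<union> centre_pt ` cells (int m) (int n)"
proof -
  have "{(of_int x, of_int y) | x y :: int. 0 \<le> x \<and> x \<le> int m \<and> 0 \<le> y \<and> y \<le> int n}
      = lattice_pt ` grid (int m) (int n)"
    by (force simp: lattice_pt_def grid_def image_def)
  moreover have "{(of_int x + 1/2, of_int y + 1/2) | x y :: int. 0 \<le> x \<and> x \<le> int m - 1 \<and> 0 \<le> y \<and> y \<le> int n - 1}
      = centre_pt ` cells (int m) (int n)"
    by (force simp: centre_pt_def cells_def image_def)
  ultimately show ?thesis by simp
qed

lemma verts_rect:
  "verts (rect_graph m n) = lattice_pt ` grid (int m) (int n) \<union> centre_pt ` cells (int m) (int n)"
  unfolding rect_graph_def rect_region induced_subgraph_def full_graph_def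
  by (auto simp: int_lattice_eq V3_eq)

lemma edges_rect_iff: "e \<in> edges (rect_graph m n) \<longleftrightarrow>
    (\<exists>x\<in>grid (int m) (int n). \<exists>z\<in>cells (int m) (int n). corner x z \<and> e = {lattice_pt x, centre_pt z}) \<or>
    (\<exists>x\<in>grid (int m) (int n). \<exists>y\<in>grid (int m) (int n). adjacent x y \<and> e = {lattice_pt x, lattice_pt y})"
proof -
  let ?W = "lattice_pt ` grid (int m) (int n) \<union> centre_pt ` cells (int m) (int n)"
  have lat: "lattice_pt x \<in> ?W \<longleftrightarrow> x \<in> grid (int m) (int n)" for x
    by (metis UnE UnI1 imageE imageI lattice_neq_centre(1) lattice_pt_eq_iff)
  have cen: "centre_pt z \<in> ?W \<longleftrightarrow> z \<in> cells (int m) (int n)" for z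
    by (metis UnE UnI2 imageE imageI lattice_neq_centre(1) centre_pt_eq_iff)
  have "e \<in> edges (rect_graph m n) \<longleftrightarrow> e \<in> E1 \<and> e \<subseteq> ?W \<or> e \<in> E2 \<and> e \<subseteq> ?W"
    unfolding rect_graph_def rect_region induced_subgraph_def full_graph_def snd_conv by blast
  also have "e \<in> E1 \<and> e \<subseteq> ?W \<longleftrightarrow> (\<exists>x\<in>grid (int m) (int n). \<exists>z\<in>cells (int m) (int n). corner x z \<and> e = {lattice_pt x, centre_pt z})"
    unfolding E1_iff using lat cen by (metis insert_subset empty_subsetI)
  also have "e \<in> E2 \<and> e \<subseteq> ?W \<longleftrightarrow> (\<exists>x\<in>grid (int m) (int n). \<exists>y\<in>grid (int m) (int n). adjacent x y \<and> e = {lattice_pt x, lattice_pt y})"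
    unfolding E2_iff using lat by (metis insert_subset empty_subsetI)
  finally show ?thesis .
qed

lemma lattice_centre_edge_iff:
  "{lattice_pt x, centre_pt z} \<in> edges (rect_graph m n) \<longleftrightarrow> x \<in> grid (int m) (int n) \<and> z \<in> cells (int m) (int n) \<and> corner x z"
  unfolding edges_rect_iff by (auto simp: doubleton_eq_iff)

lemma impurity_edge_iff:
  "e \<in> edges (rect_graph m n) \<inter> E2 \<longleftrightarrow>
    (\<exists>x\<in>grid (int m) (int n). \<exists>y\<in>grid (int m) (int n). adjacent x y \<and> e = {lattice_pt x, lattice_pt y})"
proof
  assume "e \<in> edges (rect_graph m n) \<inter> E2"
  then have "e \<in> edges (rect_graph m n)" "e \<in> E2" by auto
  moreover have "e \<noteq> {lattice_pt x, centre_pt z}" for x z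
    using \<open>e \<in> E2\<close> lattice_centre_notin_E2 by metis
  ultimately show "\<exists>x\<in>grid (int m) (int n). \<exists>y\<in>grid (int m) (int n). adjacent x y \<and> e = {lattice_pt x, lattice_pt y}"
    unfolding edges_rect_iff by blast
next
  assume *: "\<exists>x\<in>grid (int m) (int n). \<exists>y\<in>grid (int m) (int n). adjacent x y \<and> e = {lattice_pt x, lattice_pt y}"
  then have "e \<in> E2" unfolding E2_iff by blast
  with * show "e \<in> edges (rect_graph m n) \<inter> E2" unfolding Int_iff edges_rect_iff by blast
qed

lemma verts_colour:
  "verts (rect_graph m n) \<inter> colour_class b = lattice_pt ` {x \<in> grid (int m) (int n). colour x = b}"
  unfolding verts_rect colour_class_eq by auto

lemma verts_V3: "verts (rect_graph m n) \<inter> V3 = centre_pt ` cells (int m) (int n)"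
  unfolding verts_rect V3_eq by auto

section \<open>Diagonals, middle vertices and the graphs of one colour\<close>

lemma diagonal_eq: "corner x z \<Longrightarrow> diagonal (colour x) z = {lattice_pt x, lattice_pt (opp z x)}"
proof -
  assume x: "corner x z"
  then have "{y. corner y z \<and> colour y = colour x} = {x, opp z x}"
    using same_colour_corners[OF x] corner_opp[OF x] by auto
  then show ?thesis by (simp add: diagonal_def)
qed

lemma corner_ex: "\<exists>x. corner x z \<and> colour x = b"
proof -
  have "corner z z" "corner (fst z + 1, snd z) z" "colour (fst z + 1, snd z) \<longleftrightarrow> \<not> colour z"
    by (auto simp: corner_def colour_def)
  then show ?thesis by metis
qed

lemma corner_corner_opp: "corner x z' \<Longrightarrow> corner x z \<Longrightarrow> corner (opp z' x) z \<Longrightarrow> z' = z"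
  unfolding corner_def opp_def prod_eq_iff fst_conv snd_conv by presburger

lemma corner_grid: "corner x z \<Longrightarrow> z \<in> cells a b \<Longrightarrow> x \<in> grid a b"
  by (cases x) (auto simp: corner_def cells_def grid_def)

lemma middle_diagonal_iff:
  assumes "z \<in> cells (int m) (int n)"
  shows "middle_vertex (rect_graph m n) w (diagonal b z) \<longleftrightarrow> w = centre_pt z"
proof -
  obtain x where x: "corner x z" "colour x = b" using corner_ex by blast
  have o: "corner (opp z x) z" using x corner_opp by blast
  have d: "diagonal b z = {lattice_pt x, lattice_pt (opp z x)}" using diagonal_eq x by blast
  show ?thesis
  proof
    assume mid: "middle_vertex (rect_graph m n) w (diagonal b z)"
    then obtain z' where z': "z' \<in> cells (int m) (int n)" "w = centre_pt z'"
      unfolding middle_vertex_def verts_V3 by blast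
    then have "corner x z'" "corner (opp z x) z'"
      using mid unfolding middle_vertex_def d by (auto simp: lattice_centre_edge_iff)
    then show "w = centre_pt z" using z' corner_corner_opp[of x z z'] x by simp
  next
    assume "w = centre_pt z"
    then show "middle_vertex (rect_graph m n) w (diagonal b z)"
      using x o assms corner_grid unfolding middle_vertex_def d verts_V3
      by (auto simp: lattice_centre_edge_iff)
  qed
qed

lemma diagonal_inj:
  assumes "diagonal b z = diagonal b z'"
  shows "z = z'"
proof -
  obtain x where x: "corner x z" "colour x = b" using corner_ex by blast
  have "lattice_pt x \<in> diagonal b z'" "lattice_pt (opp z x) \<in> diagonal b z'"
    using diagonal_eq[OF x(1)] x(2) assms by auto
  then have "corner x z'" "corner (opp z x) z'"
    by (auto simp: diagonal_def)
  then show ?thesis using corner_corner_opp x by blast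
qed

lemma verts_diagonal_graph:
  "verts (diagonal_graph (rect_graph m n) (colour_class b)) = lattice_pt ` {x \<in> grid (int m) (int n). colour x = b}"
  unfolding diagonal_graph_def fst_conv by (rule verts_colour)

lemma edges_diagonal_graph:
  "edges (diagonal_graph (rect_graph m n) (colour_class b)) = diagonal b ` cells (int m) (int n)"
proof (intro equalityI subsetI)
  fix e assume "e \<in> edges (diagonal_graph (rect_graph m n) (colour_class b))"
  then obtain u v w where uv: "u \<in> verts (rect_graph m n) \<inter> colour_class b" "v \<in> verts (rect_graph m n) \<inter> colour_class b"
    "u \<noteq> v" "e = {u, v}" and w: "middle_vertex (rect_graph m n) w e"
    unfolding diagonal_graph_def snd_conv by blast
  then obtain x y where xy: "x \<in> grid (int m) (int n)" "y \<in> grid (int m) (int n)" "colour x = b" "colour y = b" "x \<noteq> y"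
    "e = {lattice_pt x, lattice_pt y}"
    unfolding verts_colour by blast
  obtain z where z: "z \<in> cells (int m) (int n)" "corner x z" "corner y z"
    using w unfolding middle_vertex_def verts_V3 xy(6) by (auto simp: lattice_centre_edge_iff)
  have "y = opp z x" using same_colour_corners[OF z(2,3)] xy by auto
  then show "e \<in> diagonal b ` cells (int m) (int n)" using diagonal_eq[OF z(2)] xy z by auto
next
  fix e assume "e \<in> diagonal b ` cells (int m) (int n)"
  then obtain z where z: "z \<in> cells (int m) (int n)" "e = diagonal b z" by blast
  obtain x where x: "corner x z" "colour x = b" using corner_ex by blast
  have e: "e = {lattice_pt x, lattice_pt (opp z x)}" using diagonal_eq x z by blast
  have "middle_vertex (rect_graph m n) (centre_pt z) e" using middle_diagonal_iff z by blast
  moreover have "x \<in> grid (int m) (int n)" "opp z x \<in> grid (int m) (int n)" using x z corner_grid corner_opp by blast+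
  moreover from this have "lattice_pt x \<in> verts (rect_graph m n) \<inter> colour_class b" "lattice_pt (opp z x) \<in> verts (rect_graph m n) \<inter> colour_class b"
    unfolding verts_colour using x by auto
  moreover have "lattice_pt x \<noteq> lattice_pt (opp z x)"
    using opp_neq[of z x] by simp
  ultimately show "e \<in> edges (diagonal_graph (rect_graph m n) (colour_class b))"
    unfolding diagonal_graph_def snd_conv e by blast
qed

section \<open>Dimer coverings and paired forests\<close>

lemma card_grid: "card (grid (int m) (int n)) = (m + 1) * (n + 1)"
  by (simp add: grid_def nat_add_distrib)

lemma card_cells: "card (cells (int m) (int n)) = m * n"
  by (simp add: cells_def)

definition impurity_ends :: "nat \<Rightarrow> nat \<Rightarrow> bool \<Rightarrow> point set set \<Rightarrow> (int \<times> int) set" where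
  "impurity_ends m n b I = {x \<in> grid (int m) (int n). colour x = b \<and> (\<exists>e\<in>I. lattice_pt x \<in> e)}"

lemma impurity_end:
  assumes I: "I \<subseteq> edges (rect_graph m n) \<inter> E2" and e: "e \<in> I"
  shows "\<exists>x \<in> impurity_ends m n b I. lattice_pt x \<in> e"
proof -
  obtain x y where xy: "x \<in> grid (int m) (int n)" "y \<in> grid (int m) (int n)" "adjacent x y"
    "e = {lattice_pt x, lattice_pt y}"
    using I e impurity_edge_iff by blast
  show ?thesis
  proof (cases "colour x = b")
    case True
    then show ?thesis using xy e by (intro bexI[of _ x]) (auto simp: impurity_ends_def)
  next
    case False
    then have "colour y = b" using colour_adjacent[OF xy(3)] by auto
    then show ?thesis using xy e by (intro bexI[of _ y]) (auto simp: impurity_ends_def)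
  qed
qed

lemma impurity_end_unique:
  assumes I: "I \<subseteq> edges (rect_graph m n) \<inter> E2" and e: "e \<in> I"
    and "lattice_pt x \<in> e" "lattice_pt y \<in> e" "colour x = colour y"
  shows "x = y"
proof -
  obtain u v where uv: "adjacent u v" "e = {lattice_pt u, lattice_pt v}"
    using I e impurity_edge_iff by blast
  then show ?thesis using assms(3-5) colour_adjacent[OF uv(1)] by auto
qed

lemma impurity_grid:
  assumes I: "I \<subseteq> edges (rect_graph m n) \<inter> E2" and e: "e \<in> I" "lattice_pt x \<in> e"
  shows "x \<in> grid (int m) (int n)"
proof -
  obtain u v where "u \<in> grid (int m) (int n)" "v \<in> grid (int m) (int n)" "e = {lattice_pt u, lattice_pt v}"
    using I e(1) impurity_edge_iff by blast
  then show ?thesis using e(2) by auto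
qed

lemma centre_notin_impurity:
  assumes I: "I \<subseteq> edges (rect_graph m n) \<inter> E2" and e: "e \<in> I"
  shows "centre_pt z \<notin> e"
proof -
  obtain u v where "e = {lattice_pt u, lattice_pt v}"
    using I e impurity_edge_iff by blast
  then show ?thesis by simp
qed

text \<open>Each impurity has exactly one end of each colour, and by \<open>uniq\<close> no end of
  colour \<open>b\<close> is shared by two impurities.\<close>

lemma card_impurity_ends:
  assumes I: "I \<subseteq> edges (rect_graph m n) \<inter> E2"
    and uniq: "\<And>x e e'. e \<in> I \<Longrightarrow> e' \<in> I \<Longrightarrow> lattice_pt x \<in> e \<Longrightarrow> lattice_pt x \<in> e' \<Longrightarrow> colour x = b \<Longrightarrow> e = e'"
  shows "card (impurity_ends m n b I) = card I"
proof -
  obtain g where g: "\<And>e. e \<in> I \<Longrightarrow> g e \<in> impurity_ends m n b I \<and> lattice_pt (g e) \<in> e"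
    using impurity_end[OF I, of _ b] by metis
  have "inj_on g I"
  proof (rule inj_onI)
    fix e e' assume e: "e \<in> I" "e' \<in> I" "g e = g e'"
    then show "e = e'" using g[OF e(1)] g[OF e(2)] uniq[of e e' "g e"] by (auto simp: impurity_ends_def)
  qed
  moreover have "g ` I = impurity_ends m n b I"
  proof (intro equalityI subsetI)
    fix x assume x: "x \<in> impurity_ends m n b I"
    then obtain e where e: "e \<in> I" "lattice_pt x \<in> e" by (auto simp: impurity_ends_def)
    have "x = g e"
      using impurity_end_unique[OF I e(1) e(2)] g[OF e(1)] x by (auto simp: impurity_ends_def)
    then show "x \<in> g ` I" using e by blast
  qed (use g in blast)
  ultimately show ?thesis using card_image by metis
qed

text \<open>A dimer covering in integer coordinates, split into center edges, given by
  \<open>N\<close> and \<open>c\<close>, and impurities. Both directions of the bijection pass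
  through this form.\<close>

locale dimer_data =
  fixes m n :: nat and N :: "(int \<times> int) set" and c :: "int \<times> int \<Rightarrow> int \<times> int" and I :: "point set set"
  assumes N_sub: "N \<subseteq> grid (int m) (int n)"
    and bij: "bij_betw c N (cells (int m) (int n))"
    and cor: "\<And>x. x \<in> N \<Longrightarrow> corner x (c x)"
    and I_sub: "I \<subseteq> edges (rect_graph m n) \<inter> E2"
    and I_cover: "\<And>x. x \<in> grid (int m) (int n) - N \<Longrightarrow> \<exists>e\<in>I. lattice_pt x \<in> e"
    and I_uniq: "\<And>x e e'. e \<in> I \<Longrightarrow> e' \<in> I \<Longrightarrow> lattice_pt x \<in> e \<Longrightarrow> lattice_pt x \<in> e' \<Longrightarrow> e = e'"
    and I_N: "\<And>x e. x \<in> N \<Longrightarrow> e \<in> I \<Longrightarrow> lattice_pt x \<notin> e"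
begin

text \<open>The impurity at an unmatched point provides its unmatched neighbour.\<close>

sublocale planar_matching "int m" "int n" N c
proof
  fix x assume x: "x \<in> grid (int m) (int n) - N"
  then obtain e where e: "e \<in> I" "lattice_pt x \<in> e" using I_cover by blast
  then obtain u v where uv: "u \<in> grid (int m) (int n)" "v \<in> grid (int m) (int n)" "adjacent u v"
    "e = {lattice_pt u, lattice_pt v}"
    using I_sub impurity_edge_iff by blast
  have "u \<notin> N" "v \<notin> N" using I_N[of u e] I_N[of v e] e uv(4) by blast+
  moreover have "adjacent v u" using uv(3) by (simp add: adjacent_def abs_minus_commute)
  ultimately show "\<exists>y\<in>grid (int m) (int n) - N. adjacent x y" using uv e by auto
qed (use N_sub bij cor in auto)

definition matching :: "point set set" where
  "matching = I \<union> (\<lambda>x. {lattice_pt x, centre_pt (c x)}) ` N"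

lemma matching_E2: "matching \<inter> E2 = I"
  using I_sub lattice_centre_notin_E2 by (auto simp: matching_def)

lemma lattice_centre_matching_iff: "{lattice_pt x, centre_pt z} \<in> matching \<longleftrightarrow> x \<in> N \<and> z = c x"
proof -
  have "{lattice_pt x, centre_pt z} \<notin> I"
    using I_sub lattice_centre_notin_E2 by blast
  then show ?thesis
    unfolding matching_def by (auto simp: doubleton_eq_iff)
qed

lemma matching_dimer: "matching \<in> dimer_coverings (rect_graph m n)"
  unfolding dimer_coverings_def mem_Collect_eq
proof (intro conjI ballI)
  have "{lattice_pt x, centre_pt (c x)} \<in> edges (rect_graph m n)" if "x \<in> N" for x
    using that N_sub cor bij_betwE[OF bij] unfolding lattice_centre_edge_iff by blast
  then show "matching \<subseteq> edges (rect_graph m n)"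
    using I_sub unfolding matching_def by blast
next
  fix v assume "v \<in> verts (rect_graph m n)"
  then consider (L) x where "x \<in> grid (int m) (int n)" "v = lattice_pt x"
    | (C) z where "z \<in> cells (int m) (int n)" "v = centre_pt z"
    unfolding verts_rect by blast
  then show "\<exists>!e. e \<in> matching \<and> v \<in> e"
  proof cases
    case L
    show ?thesis
    proof (cases "x \<in> N")
      case True
      show ?thesis
      proof (rule ex1I[of _ "{lattice_pt x, centre_pt (c x)}"])
        show "{lattice_pt x, centre_pt (c x)} \<in> matching \<and> v \<in> {lattice_pt x, centre_pt (c x)}"
          using True L by (simp add: lattice_centre_matching_iff)
        fix e assume "e \<in> matching \<and> v \<in> e"
        then show "e = {lattice_pt x, centre_pt (c x)}"
          using I_N[OF True] L by (auto simp: matching_def)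
      qed
    next
      case False
      then obtain e where e: "e \<in> I" "lattice_pt x \<in> e" using I_cover L by blast
      show ?thesis
      proof (rule ex1I[of _ e])
        show "e \<in> matching \<and> v \<in> e" using e L by (simp add: matching_def)
        fix e' assume "e' \<in> matching \<and> v \<in> e'"
        then show "e' = e" using I_uniq[of e' e x] e L False by (auto simp: matching_def)
      qed
    qed
  next
    case C
    then obtain x where x: "x \<in> N" "c x = z" using mate_ex by blast
    show ?thesis
    proof (rule ex1I[of _ "{lattice_pt x, centre_pt z}"])
      show "{lattice_pt x, centre_pt z} \<in> matching \<and> v \<in> {lattice_pt x, centre_pt z}"
        using x C by (simp add: lattice_centre_matching_iff)
      fix e assume e: "e \<in> matching \<and> v \<in> e"
      then have "e \<notin> I" using centre_notin_impurity[OF I_sub] C by blast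
      then obtain y where y: "y \<in> N" "e = {lattice_pt y, centre_pt (c y)}" using e by (auto simp: matching_def)
      then have "c y = z" using e C by simp
      then have "y = x" using x y bij_betw_imp_inj_on[OF bij] by (metis inj_onD)
      then show "e = {lattice_pt x, centre_pt z}" using y x by simp
    qed
  qed
qed

lemma ends_eq: "impurity_ends m n b I = {x \<in> grid (int m) (int n) - N. colour x = b}"
  unfolding impurity_ends_def using I_cover I_N by blast

lemma card_ends: "card (impurity_ends m n b I) = card I"
  by (rule card_impurity_ends[OF I_sub I_uniq])

text \<open>The unmatched points number \<open>(m + 1) * (n + 1) - m * n\<close>, and each colour
  has as many of them as there are impurities.\<close>

lemma card_I: "2 * card I = m + n + 1"
proof -
  have "card (impurity_ends m n True I) + card (impurity_ends m n False I) = card (grid (int m) (int n) - N)"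
  proof (subst card_Un_disjoint[symmetric])
    show "card (impurity_ends m n True I \<union> impurity_ends m n False I) = card (grid (int m) (int n) - N)"
      by (rule arg_cong[of _ _ card]) (auto simp: ends_eq)
  qed (auto simp: ends_eq)
  also have "\<dots> = (m + 1) * (n + 1) - m * n"
    using card_Diff_subset[OF finite_N N_sub] bij_betw_same_card[OF bij] by (simp add: card_grid card_cells)
  finally show ?thesis by (simp add: card_ends)
qed

end

text \<open>Built from the edge set \<open>M\<close> alone, so that the bijection can be written
  down before any choice of \<open>N\<close> and \<open>c\<close>.\<close>

definition forest_of :: "nat \<Rightarrow> nat \<Rightarrow> bool \<Rightarrow> point set set \<Rightarrow> point ugraph" where
  "forest_of m n b M = (lattice_pt ` {x \<in> grid (int m) (int n). colour x = b},
     diagonal b ` {z \<in> cells (int m) (int n). \<exists>x. colour x = b \<and> {lattice_pt x, centre_pt z} \<in> M})"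

section \<open>From a covering to a pair of forests\<close>

context dimer_data
begin

lemma verts_forest:
  "verts (forest_of m n b matching) = lattice_pt ` {x \<in> grid (int m) (int n). colour x = b}"
  by (simp add: forest_of_def)

lemma edges_forest: "edges (forest_of m n b matching) = diagonal b ` c ` {x \<in> N. colour x = b}"
proof -
  have "{z \<in> cells (int m) (int n). \<exists>x. colour x = b \<and> {lattice_pt x, centre_pt z} \<in> matching}
      = c ` {x \<in> N. colour x = b}"
    unfolding lattice_centre_matching_iff using bij_betwE[OF bij] by blast
  then show ?thesis by (simp add: forest_of_def)
qed

text \<open>\<open>p\<close> carried over to real points, where the forests live; only its values on
  lattice points matter.\<close>

definition lp :: "point \<Rightarrow> point" where
  "lp v = lattice_pt (p (inv lattice_pt v))"

lemma inv_lattice_pt [simp]: "inv lattice_pt (lattice_pt x) = x"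
  by (rule inv_f_f) (simp add: inj_def)

lemma lp [simp]: "lp (lattice_pt x) = lattice_pt (p x)"
  by (simp add: lp_def)

lemma wf_lp: "wf {(lp v, v) | v. v \<in> lattice_pt ` {x \<in> N. colour x = b}}"
  by (rule wf_subset[OF wf_inv_image[OF wf_p, of "inv lattice_pt"]]) (auto simp: inv_image_def)

lemma edges_forest_lp:
  "edges (forest_of m n b matching) = {{v, lp v} | v. v \<in> lattice_pt ` {x \<in> N. colour x = b}}"
proof -
  have "diagonal b (c x) = {lattice_pt x, lp (lattice_pt x)}" if "x \<in> N" "colour x = b" for x
    using diagonal_eq[OF cor[OF that(1)]] that by (simp add: p_def)
  then have "diagonal b ` c ` {x \<in> N. colour x = b} = (\<lambda>x. {lattice_pt x, lp (lattice_pt x)}) ` {x \<in> N. colour x = b}"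
    unfolding image_image by (intro image_cong) blast+
  also have "\<dots> = {{v, lp v} | v. v \<in> lattice_pt ` {x \<in> N. colour x = b}}"
    by blast
  finally show ?thesis unfolding edges_forest .
qed

lemma ends_lattice:
  "lattice_pt ` {x \<in> grid (int m) (int n). colour x = b} - lattice_pt ` {x \<in> N. colour x = b}
    = lattice_pt ` impurity_ends m n b I"
  unfolding ends_eq by auto

lemma lp_sub:
  "lattice_pt ` {x \<in> N. colour x = b} \<subseteq> lattice_pt ` {x \<in> grid (int m) (int n). colour x = b}"
  "lp ` lattice_pt ` {x \<in> N. colour x = b} \<subseteq> lattice_pt ` {x \<in> grid (int m) (int n). colour x = b}"
  using N_sub p_grid by auto

lemmas components =
  functional_forest_components[OF wf_lp lp_sub verts_forest edges_forest_lp, unfolded ends_lattice]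

lemma spanning_forest_of:
  "spanning_forest (diagonal_graph (rect_graph m n) (colour_class b)) (forest_of m n b matching)"
  unfolding spanning_forest_def
proof (intro conjI)
  show "verts (forest_of m n b matching) = verts (diagonal_graph (rect_graph m n) (colour_class b))"
    unfolding verts_forest verts_diagonal_graph ..
  show "edges (forest_of m n b matching) \<subseteq> edges (diagonal_graph (rect_graph m n) (colour_class b))"
    unfolding edges_forest edges_diagonal_graph using bij_betwE[OF bij] by blast
  show "\<nexists>c. is_cycle (forest_of m n b matching) c"
  proof -
    have "finite (lattice_pt ` {x \<in> N. colour x = b})" using finite_N by simp
    from functional_forest_acyclic[OF this wf_lp, of "forest_of m n b matching"] edges_forest_lp[of b]
    show ?thesis by blast
  qed
qed

lemma card_components: "card (conn_components (forest_of m n b matching)) = card I"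
  using components(2)[of b] card_ends[of b] by (simp add: card_image inj_on_def)

text \<open>A tree has exactly one root, the roots are the impurity ends of its colour, and each end
  lies on a single impurity.\<close>

lemma forest_paired:
  assumes T: "T \<in> conn_components (forest_of m n b matching)"
  shows "\<exists>!e. e \<in> I \<and> (\<exists>x \<in> e \<inter> colour_class b. x \<in> T)"
proof -
  have "\<exists>!r. r \<in> lattice_pt ` impurity_ends m n b I \<and> r \<in> T"
    using components(1)[OF T] .
  then obtain x where x: "x \<in> impurity_ends m n b I" "lattice_pt x \<in> T"
    and ux: "\<And>y. y \<in> impurity_ends m n b I \<Longrightarrow> lattice_pt y \<in> T \<Longrightarrow> y = x"
    by (metis imageE imageI lattice_pt_eq_iff)
  obtain e where e: "e \<in> I" "lattice_pt x \<in> e" "colour x = b"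
    using x(1) unfolding impurity_ends_def by blast
  show ?thesis
  proof (rule ex1I[of _ e])
    show "e \<in> I \<and> (\<exists>x \<in> e \<inter> colour_class b. x \<in> T)"
      using e x by (auto simp: colour_class_eq)
    fix e' assume "e' \<in> I \<and> (\<exists>x \<in> e' \<inter> colour_class b. x \<in> T)"
    then obtain y where y: "e' \<in> I" "lattice_pt y \<in> e'" "colour y = b" "lattice_pt y \<in> T"
      by (auto simp: colour_class_eq)
    then have "y \<in> impurity_ends m n b I"
      using impurity_grid[OF I_sub] by (auto simp: impurity_ends_def)
    then show "e' = e" using ux y e I_uniq by metis
  qed
qed

lemma forest_triple:
  assumes "k = (m + n + 1) div 2"
  shows "(forest_of m n True matching, forest_of m n False matching, matching \<inter> E2)
    \<in> forest_triples (rect_graph m n) k"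
proof -
  have k: "card I = k" using assms card_I by simp
  have k0: "card I > 0" using card_I by linarith
  have "no_intersections (rect_graph m n) (forest_of m n True matching) (forest_of m n False matching)"
    unfolding no_intersections_def
  proof (intro notI, elim bexE conjE)
    fix w d d' assume d: "d \<in> edges (forest_of m n True matching)" "d' \<in> edges (forest_of m n False matching)"
      "middle_vertex (rect_graph m n) w d" "middle_vertex (rect_graph m n) w d'"
    obtain x y where xy: "x \<in> N" "colour x" "d = diagonal True (c x)" "y \<in> N" "\<not> colour y" "d' = diagonal False (c y)"
      using d(1,2) unfolding edges_forest by auto
    have "c x \<in> cells (int m) (int n)" "c y \<in> cells (int m) (int n)" using bij_betwE[OF bij] xy by auto
    \<comment> \<open>A common middle vertex puts both diagonals into one square, whose only partner
      has one colour.\<close>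
    then have "centre_pt (c x) = centre_pt (c y)"
      using d(3,4) xy by (simp add: middle_diagonal_iff)
    then have "x = y" using xy bij_betw_imp_inj_on[OF bij] by (auto dest: inj_onD)
    then show False using xy by simp
  qed
  moreover have "paired_by (forest_of m n True matching) (forest_of m n False matching) I"
    unfolding paired_by_def using forest_paired[of _ True] forest_paired[of _ False]
    by (simp add: colour_class_def)
  moreover have "finite I" using k0 by (rule card_ge_0_finite)
  ultimately show ?thesis
    unfolding forest_triples_def matching_E2
    using spanning_forest_of[of True] spanning_forest_of[of False] card_components I_sub k
    by (simp add: colour_class_def)
qed

end

lemma dimer_data_of_covering:
  assumes M: "M \<in> dimer_coverings (rect_graph m n)"
  obtains N c where "dimer_data m n N c (M \<inter> E2)" "M = dimer_data.matching N c (M \<inter> E2)"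
proof -
  let ?B = "grid (int m) (int n)" and ?Z = "cells (int m) (int n)"
  have sub: "M \<subseteq> edges (rect_graph m n)" and cov: "\<And>v. v \<in> verts (rect_graph m n) \<Longrightarrow> \<exists>!e. e \<in> M \<and> v \<in> e"
    using M by (auto simp: dimer_coverings_def)
  have covB: "\<exists>!e. e \<in> M \<and> lattice_pt x \<in> e" if "x \<in> ?B" for x
    using cov that unfolding verts_rect by blast
  have covZ: "\<exists>!e. e \<in> M \<and> centre_pt z \<in> e" if "z \<in> ?Z" for z
    using cov that unfolding verts_rect by blast
  define N where "N = {x \<in> ?B. \<exists>z. {lattice_pt x, centre_pt z} \<in> M}"
  have "\<forall>x\<in>N. \<exists>z. {lattice_pt x, centre_pt z} \<in> M"
    unfolding N_def by blast
  from bchoice[OF this] obtain c where c: "\<And>x. x \<in> N \<Longrightarrow> {lattice_pt x, centre_pt (c x)} \<in> M"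
    by blast
  have edge: "x \<in> N \<and> z \<in> ?Z \<and> corner x z" if "{lattice_pt x, centre_pt z} \<in> M" for x z
  proof -
    have "{lattice_pt x, centre_pt z} \<in> edges (rect_graph m n)" using that sub by blast
    then show ?thesis using that unfolding lattice_centre_edge_iff N_def by blast
  qed
  have kind: "(\<exists>x\<in>N. \<exists>z. e = {lattice_pt x, centre_pt z}) \<or> e \<in> E2" if e: "e \<in> M" for e
  proof -
    have "e \<in> edges (rect_graph m n)" using e sub by blast
    then consider x z where "e = {lattice_pt x, centre_pt z}" | x y where "adjacent x y" "e = {lattice_pt x, lattice_pt y}"
      unfolding edges_rect_iff by blast
    then show ?thesis
    proof cases
      case 1
      then show ?thesis using e edge by blast
    next
      case 2
      then show ?thesis unfolding E2_iff by blast
    qed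
  qed
  have c_eq: "z = c x" if "{lattice_pt x, centre_pt z} \<in> M" for x z
  proof -
    have "x \<in> N" using edge that by blast
    then have "{lattice_pt x, centre_pt z} = {lattice_pt x, centre_pt (c x)}"
      using covB[of x] c that unfolding N_def by blast
    then show ?thesis by (auto simp: doubleton_eq_iff)
  qed
  have data: "dimer_data m n N c (M \<inter> E2)"
  proof
    show "N \<subseteq> ?B" by (auto simp: N_def)
    show "corner x (c x)" if "x \<in> N" for x using edge c that by blast
    show "M \<inter> E2 \<subseteq> edges (rect_graph m n) \<inter> E2" using sub by blast
    show "bij_betw c N ?Z"
    proof (rule bij_betwI')
      show "c x \<in> ?Z" if "x \<in> N" for x using edge c that by blast
      fix x y assume xy: "x \<in> N" "y \<in> N"
      show "c x = c y \<longleftrightarrow> x = y"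
      proof
        assume "c x = c y"
        then have "{lattice_pt x, centre_pt (c x)} = {lattice_pt y, centre_pt (c x)}"
          using covZ[of "c x"] c[OF xy(1)] c[OF xy(2)] edge[OF c[OF xy(1)]] by (metis insertCI)
        then show "x = y" by (auto simp: doubleton_eq_iff)
      qed simp
    next
      fix z assume "z \<in> ?Z"
      then obtain e where e: "e \<in> M" "centre_pt z \<in> e" using covZ by blast
      have "e \<notin> E2" using e(2) unfolding E2_iff by auto
      then obtain x z' where x: "x \<in> N" "e = {lattice_pt x, centre_pt z'}" using kind e(1) by blast
      then have "z' = z" using e(2) by simp
      then show "\<exists>x\<in>N. z = c x" using c_eq x e(1) by blast
    qed
  next
    fix x assume x: "x \<in> ?B - N"
    then obtain e where e: "e \<in> M" "lattice_pt x \<in> e" using covB by blast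
    have "e \<in> E2"
    proof (rule ccontr)
      assume "e \<notin> E2"
      then obtain y z where "y \<in> N" "e = {lattice_pt y, centre_pt z}" using kind e(1) by blast
      then show False using e(2) x by simp
    qed
    then show "\<exists>e\<in>M \<inter> E2. lattice_pt x \<in> e" using e by blast
  next
    fix x e e' assume e: "e \<in> M \<inter> E2" "e' \<in> M \<inter> E2" "lattice_pt x \<in> e" "lattice_pt x \<in> e'"
    have "M \<inter> E2 \<subseteq> edges (rect_graph m n) \<inter> E2" using sub by blast
    then have "x \<in> ?B" using impurity_grid e by blast
    then show "e = e'" using covB e by blast
  next
    fix x e assume x: "x \<in> N" and e: "e \<in> M \<inter> E2"
    show "lattice_pt x \<notin> e"
    proof
      assume "lattice_pt x \<in> e"
      then have "e = {lattice_pt x, centre_pt (c x)}"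
        using covB[of x] c[OF x] x e unfolding N_def by blast
      then show False using e lattice_centre_notin_E2 by blast
    qed
  qed
  moreover have "M = dimer_data.matching N c (M \<inter> E2)"
    unfolding dimer_data.matching_def[OF data]
  proof (intro equalityI subsetI)
    fix e assume "e \<in> M"
    then show "e \<in> M \<inter> E2 \<union> (\<lambda>x. {lattice_pt x, centre_pt (c x)}) ` N"
      using kind[of e] c_eq by blast
  next
    fix e assume "e \<in> M \<inter> E2 \<union> (\<lambda>x. {lattice_pt x, centre_pt (c x)}) ` N"
    then show "e \<in> M" using c by blast
  qed
  ultimately show thesis using that by blast
qed

text \<open>The impurities determine \<open>N\<close>. Going outwards from the roots, the edge in
  square \<open>c v\<close> must come from \<open>v\<close> or from \<open>p v\<close> in the second
  covering. In the latter case the induction hypothesis gives \<open>c (p v) = c v\<close>, against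
  injectivity.\<close>

lemma matching_unique:
  assumes "dimer_data m n N c I" "dimer_data m n N' c' I"
    and eq: "\<And>b. edges (forest_of m n b (dimer_data.matching N c I)) =
      edges (forest_of m n b (dimer_data.matching N' c' I))"
  shows "dimer_data.matching N c I = dimer_data.matching N' c' I"
proof -
  interpret d: dimer_data m n N c I by fact
  interpret d': dimer_data m n N' c' I by fact
  have "x \<in> N \<longleftrightarrow> x \<in> grid (int m) (int n) \<and> (\<forall>e\<in>I. lattice_pt x \<notin> e)" for x
    using d.N_sub d.I_cover d.I_N by blast
  moreover have "x \<in> N' \<longleftrightarrow> x \<in> grid (int m) (int n) \<and> (\<forall>e\<in>I. lattice_pt x \<notin> e)" for x
    using d'.N_sub d'.I_cover d'.I_N by blast
  ultimately have NN: "N' = N" by blast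
  have "v \<in> N \<longrightarrow> c v = c' v" for v
    using d.wf_p
  proof (induction v rule: wf_induct_rule)
    case (less v)
    show ?case
    proof (intro impI, rule ccontr)
      assume v: "v \<in> N" "c v \<noteq> c' v"
      have "diagonal (colour v) (c v) \<in> edges (forest_of m n (colour v) d'.matching)"
        using eq[of "colour v"] v unfolding d.edges_forest by blast
      then obtain u where "u \<in> N'" "colour u = colour v" "diagonal (colour v) (c v) = diagonal (colour v) (c' u)"
        unfolding d'.edges_forest by blast
      then have u: "u \<in> N" "colour u = colour v" "c' u = c v"
        using diagonal_inj NN by blast+
      have "corner u (c v)" using d'.cor[of u] u NN by simp
      then have "u = v \<or> u = d.p v"
        using same_colour_corners[OF d.cor[OF v(1)]] u by (auto simp: d.p_def)
      then have up: "u = d.p v" using u v by auto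
      have "u \<noteq> v" using up d.p_neq by metis
      then have "c u \<noteq> c' u" using u v bij_betw_imp_inj_on[OF d.bij] by (metis inj_onD)
      then show False using less[of u] up u v by blast
    qed
  qed
  then have "(\<lambda>x. {lattice_pt x, centre_pt (c x)}) ` N = (\<lambda>x. {lattice_pt x, centre_pt (c' x)}) ` N'"
    unfolding NN by (intro image_cong) auto
  then show ?thesis
    unfolding d.matching_def d'.matching_def by simp
qed

text \<open>Orient each forest towards its impurity ends and let \<open>c x\<close> be the square
  crossed by the outgoing edge of \<open>x\<close>. Injectivity and a count make \<open>c\<close> a
  bijection onto the squares, so every forest edge is an outgoing edge.\<close>

lemma triple_data:
  assumes k: "2 * k = m + n + 1"
    and I: "I \<subseteq> edges (rect_graph m n) \<inter> E2" "card I = k"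
    and F: "\<And>b. spanning_forest (diagonal_graph (rect_graph m n) (colour_class b)) (F b)"
    and disj: "no_intersections (rect_graph m n) (F True) (F False)"
    and pair: "\<And>b T. T \<in> conn_components (F b) \<Longrightarrow> \<exists>!e. e \<in> I \<and> (\<exists>x \<in> e \<inter> colour_class b. x \<in> T)"
  obtains N c where "dimer_data m n N c I" "\<And>b. F b = forest_of m n b (dimer_data.matching N c I)"
proof -
  let ?B = "grid (int m) (int n)" and ?Z = "cells (int m) (int n)"
  let ?R = "\<lambda>b. impurity_ends m n b I"
  have V: "verts (F b) = lattice_pt ` {x \<in> ?B. colour x = b}" for b
    using F[of b] unfolding spanning_forest_def verts_diagonal_graph by blast
  have E: "edges (F b) \<subseteq> diagonal b ` ?Z" for b
    using F[of b] unfolding spanning_forest_def edges_diagonal_graph by blast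
  have uniq: "e = e'" if e: "e \<in> I" "e' \<in> I" "lattice_pt x \<in> e" "lattice_pt x \<in> e'" for x e e'
  proof -
    have "x \<in> ?B" using impurity_grid[OF I(1)] e by blast
    then have v: "lattice_pt x \<in> verts (F (colour x))" unfolding V by blast
    have "lattice_pt x \<in> colour_class (colour x)" by (auto simp: colour_class_eq)
    then show ?thesis
      using pair[OF component_of(1)[OF v]] component_of(2)[OF v] e by blast
  qed
  have card_R: "card (?R b) = k" for b
    using card_impurity_ends[OF I(1) uniq] I(2) by simp
  let ?W = "\<lambda>b. lattice_pt ` {x \<in> ?B. colour x = b}"
  have "\<exists>q. (\<forall>v\<in>?W b - lattice_pt ` ?R b. {v, q v} \<in> edges (F b)) \<and>
      wf {(q v, v) | v. v \<in> ?W b - lattice_pt ` ?R b}" for b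
  proof -
    have "\<exists>r. r \<in> lattice_pt ` ?R b \<and> r \<in> T" if T: "T \<in> conn_components (F b)" for T
    proof -
      obtain e v where "e \<in> I" "v \<in> e" "v \<in> colour_class b" "v \<in> T" using pair[OF T] by blast
      moreover from this obtain x where "v = lattice_pt x" "colour x = b" unfolding colour_class_eq by blast
      moreover from calculation have "x \<in> ?R b"
        using impurity_grid[OF I(1)] unfolding impurity_ends_def by blast
      ultimately show ?thesis by blast
    qed
    from orientation_towards_roots[OF V this] show ?thesis .
  qed
  then have "\<forall>b. \<exists>q. (\<forall>v\<in>?W b - lattice_pt ` ?R b. {v, q v} \<in> edges (F b)) \<and>
      wf {(q v, v) | v. v \<in> ?W b - lattice_pt ` ?R b}" by blast
  from choice[OF this] obtain q where q: "\<And>b v. v \<in> ?W b - lattice_pt ` ?R b \<Longrightarrow> {v, q b v} \<in> edges (F b)"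
    and wfq: "\<And>b. wf {(q b v, v) | v. v \<in> ?W b - lattice_pt ` ?R b}"
    by blast
  define N where "N = ?B - (?R True \<union> ?R False)"
  have NR: "x \<in> ?B \<and> x \<notin> ?R (colour x)" if "x \<in> N" for x
    using that by (cases "colour x") (auto simp: N_def)
  have NW: "lattice_pt x \<in> ?W (colour x) - lattice_pt ` ?R (colour x)" if "x \<in> N" for x
    using NR[OF that] by auto
  have "\<exists>z\<in>?Z. corner x z \<and> diagonal (colour x) z \<in> edges (F (colour x)) \<and> q (colour x) (lattice_pt x) = lattice_pt (opp z x)"
    if x: "x \<in> N" for x
  proof -
    have e: "{lattice_pt x, q (colour x) (lattice_pt x)} \<in> edges (F (colour x))"
      by (rule q[OF NW[OF x]])
    then obtain z where z: "z \<in> ?Z" "{lattice_pt x, q (colour x) (lattice_pt x)} = diagonal (colour x) z"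
      using E by blast
    then have "lattice_pt x \<in> diagonal (colour x) z" by blast
    then have "corner x z" by (auto simp: diagonal_def)
    moreover from this have "q (colour x) (lattice_pt x) = lattice_pt (opp z x)"
      using z(2) diagonal_eq by (metis doubleton_eq_iff)
    ultimately show ?thesis using z e by metis
  qed
  then obtain c where c: "\<And>x. x \<in> N \<Longrightarrow> c x \<in> ?Z \<and> corner x (c x) \<and> diagonal (colour x) (c x) \<in> edges (F (colour x))
      \<and> q (colour x) (lattice_pt x) = lattice_pt (opp (c x) x)"
    by metis
  have disj': "False" if "z \<in> ?Z" "diagonal True z \<in> edges (F True)" "diagonal False z \<in> edges (F False)" for z
  proof -
    have "centre_pt z \<in> verts (rect_graph m n) \<inter> V3" using that verts_V3 by blast
    then show False using disj that middle_diagonal_iff[OF that(1)] unfolding no_intersections_def by blast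
  qed
  define r where "r b = {(q b v, v) | v. v \<in> ?W b - lattice_pt ` ?R b}" for b
  have r: "(q (colour x) (lattice_pt x), lattice_pt x) \<in> r (colour x)" if "x \<in> N" for x
    unfolding r_def using NW[OF that] by blast
  have wfr: "wf (r b)" for b
    unfolding r_def by (rule wfq)
  \<comment> \<open>Two points sharing a square would give an intersection of the forests if their
    colours differ. If the colours agree, the orientation \<open>q\<close> would exchange the
    points, against well-foundedness.\<close>
  have inj: "inj_on c N"
  proof (rule inj_onI, rule ccontr)
    fix x y assume x: "x \<in> N" and y: "y \<in> N" and eq: "c x = c y" and ne: "x \<noteq> y"
    show False
    proof (cases "colour x = colour y")
      case False
      then show False using disj'[of "c x"] c[OF x] c[OF y] eq by (cases "colour x"; cases "colour y") auto
    next
      case True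
      then have o: "y = opp (c x) x"
        using same_colour_corners[of x "c x" y] c[OF x] c[OF y] eq ne by simp
      then have o': "x = opp (c y) y"
        using eq opp_opp by metis
      have "q (colour x) (lattice_pt x) = lattice_pt y" "q (colour x) (lattice_pt y) = lattice_pt x"
        using c[OF x] c[OF y] o[symmetric] o'[symmetric] True by simp_all
      then have "(lattice_pt y, lattice_pt x) \<in> r (colour x)" "(lattice_pt x, lattice_pt y) \<in> r (colour x)"
        using r[OF x] r[OF y] True by simp_all
      then show False using wf_not_sym[OF wfr] by metis
    qed
  qed
  \<comment> \<open>Removing \<open>2 * k = m + n + 1\<close> ends from
    \<open>(m + 1) * (n + 1)\<close> points leaves \<open>m * n\<close>, the number of
    squares.\<close>
  have "card N = card ?Z"
  proof -
    have "finite (?R b)" for b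
      by (rule finite_subset[of _ ?B]) (auto simp: impurity_ends_def)
    moreover have "?R True \<inter> ?R False = {}"
      by (auto simp: impurity_ends_def)
    ultimately have "card (?R True \<union> ?R False) = 2 * k"
      using card_R by (simp add: card_Un_disjoint)
    moreover have "card N = card ?B - card (?R True \<union> ?R False)"
      unfolding N_def using \<open>\<And>b. finite (?R b)\<close>
      by (intro card_Diff_subset) (auto simp: impurity_ends_def)
    ultimately show ?thesis using k by (simp add: card_grid card_cells)
  qed
  moreover have "c ` N \<subseteq> ?Z" using c by blast
  ultimately have cN: "c ` N = ?Z"
    using card_image[OF inj] by (intro card_subset_eq) auto
  have data: "dimer_data m n N c I"
  proof
    show "N \<subseteq> ?B" by (auto simp: N_def)
    show "bij_betw c N ?Z" using inj cN by (simp add: bij_betw_def)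
    show "corner x (c x)" if "x \<in> N" for x using c that by blast
    show "\<exists>e\<in>I. lattice_pt x \<in> e" if "x \<in> ?B - N" for x
      using that by (auto simp: N_def impurity_ends_def)
    show "lattice_pt x \<notin> e" if "x \<in> N" "e \<in> I" for x e
      using that NR[of x] by (auto simp: impurity_ends_def)
  qed (use I uniq in blast)+
  moreover have "F b = forest_of m n b (dimer_data.matching N c I)" for b
  proof -
    interpret d: dimer_data m n N c I by (rule data)
    have "edges (F b) = diagonal b ` c ` {x \<in> N. colour x = b}"
    proof (intro equalityI subsetI)
      fix e assume e: "e \<in> edges (F b)"
      then obtain z where z: "z \<in> ?Z" "e = diagonal b z" using E by blast
      obtain x where x: "x \<in> N" "c x = z" using z(1) unfolding cN[symmetric] by blast
      \<comment> \<open>Otherwise the square \<open>z\<close> would be crossed by \<open>e\<close>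
        and by the outgoing edge of \<open>x\<close> in the other forest.\<close>
      have "colour x = b"
      proof (rule ccontr)
        assume "colour x \<noteq> b"
        then show False using disj'[OF z(1)] c[OF x(1)] x e z by (cases b; cases "colour x") auto
      qed
      then show "e \<in> diagonal b ` c ` {x \<in> N. colour x = b}" using x z by blast
    next
      fix e assume "e \<in> diagonal b ` c ` {x \<in> N. colour x = b}"
      then show "e \<in> edges (F b)" using c by blast
    qed
    then show ?thesis
      using V[of b] d.verts_forest[of b] d.edges_forest[of b] by (simp add: prod_eq_iff)
  qed
  ultimately show thesis using that by blast
qed

section \<open>The bijection\<close>

theorem theorem1:
  fixes m n k :: nat
  assumes "m > 0" and "n > 0" and "odd (m + n)"
    and "k = (m + n + 1) div 2"
  shows "\<exists>f. bij_betw f (dimer_coverings (rect_graph m n)) (forest_triples (rect_graph m n) k)"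
proof -
  define f where "f M = (forest_of m n True M, forest_of m n False M, M \<inter> E2)" for M
  have "bij_betw f (dimer_coverings (rect_graph m n)) (forest_triples (rect_graph m n) k)"
  proof (rule bij_betw_imageI)
    show "inj_on f (dimer_coverings (rect_graph m n))"
    proof (rule inj_onI)
      fix M M' assume M: "M \<in> dimer_coverings (rect_graph m n)" and M': "M' \<in> dimer_coverings (rect_graph m n)"
        and eq: "f M = f M'"
      obtain N c where Nc: "dimer_data m n N c (M \<inter> E2)" "M = dimer_data.matching N c (M \<inter> E2)"
        using dimer_data_of_covering[OF M] .
      obtain N' c' where Nc': "dimer_data m n N' c' (M' \<inter> E2)" "M' = dimer_data.matching N' c' (M' \<inter> E2)"
        using dimer_data_of_covering[OF M'] .
      have I: "M' \<inter> E2 = M \<inter> E2" using eq by (simp add: f_def)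
      have "forest_of m n b M = forest_of m n b M'" for b
        using eq by (cases b) (simp_all add: f_def)
      then show "M = M'"
        using matching_unique[OF Nc(1) Nc'(1)[unfolded I]] Nc(2) Nc'(2) I by metis
    qed
  next
    show "f ` dimer_coverings (rect_graph m n) = forest_triples (rect_graph m n) k"
    proof (intro equalityI subsetI)
      fix t assume "t \<in> f ` dimer_coverings (rect_graph m n)"
      then obtain M where M: "M \<in> dimer_coverings (rect_graph m n)" "t = f M" by blast
      obtain N c where Nc: "dimer_data m n N c (M \<inter> E2)" "M = dimer_data.matching N c (M \<inter> E2)"
        using dimer_data_of_covering[OF M(1)] .
      show "t \<in> forest_triples (rect_graph m n) k"
        using dimer_data.forest_triple[OF Nc(1) assms(4)] Nc(2) M(2) by (simp add: f_def)
    next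
      fix t assume t: "t \<in> forest_triples (rect_graph m n) k"
      obtain F1 F2 I where t_eq: "t = (F1, F2, I)" by (cases t)
      define F where "F b = (if b then F1 else F2)" for b
      have k: "2 * k = m + n + 1" using assms(3,4) by presburger
      have I: "I \<subseteq> edges (rect_graph m n) \<inter> E2" "card I = k"
        and disj: "no_intersections (rect_graph m n) (F True) (F False)"
        using t by (auto simp: t_eq forest_triples_def F_def)
      have sp: "spanning_forest (diagonal_graph (rect_graph m n) (colour_class b)) (F b)" for b
        using t by (auto simp: t_eq forest_triples_def F_def colour_class_def)
      have pair: "\<exists>!e. e \<in> I \<and> (\<exists>x \<in> e \<inter> colour_class b. x \<in> T)" if "T \<in> conn_components (F b)" for b T
      proof -
        have "paired_by F1 F2 I" using t by (simp add: t_eq forest_triples_def)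
        then show ?thesis using that unfolding paired_by_def F_def colour_class_def by (cases b) simp_all
      qed
      obtain N c where Nc: "dimer_data m n N c I" and Fb: "\<And>b. F b = forest_of m n b (dimer_data.matching N c I)"
        using triple_data[OF k I sp disj pair] by metis
      interpret d: dimer_data m n N c I by (rule Nc)
      have "t = f d.matching"
        using Fb[of True] Fb[of False] d.matching_E2 by (simp add: f_def t_eq F_def)
      then show "t \<in> f ` dimer_coverings (rect_graph m n)"
        using d.matching_dimer by blast
    qed
  qed
  then show ?thesis by blast
qed

end
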